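(* For every dimensional function $\mathcal{D}$, the set $\mathcal{I}(\mathcal{D})$, equipped with the restriction of the Gromov--Hausdorff distance, is a geodesic space; and the set $\mathcal{CA}$, equipped with the restriction of the Gromov--Hausdorff distance, is a geodesic space.
   Context: $\mathcal{M}$ is the set of all isometry classes of non-empty compact metric spaces, equipped with the Gromov--Hausdorff distance $d_{GH}$. $\delta_e(Y)$ denotes the diameter. A map $\mathcal{D}:\mathcal{M}\to[0,\infty]$ is a dimensional function if (i) for every $(X,d)\in\mathcal{M}$ and every (non-empty) closed subset $A$ of $X$ we have $\mathcal{D}(A,d)\le\mathcal{D}(X,d)$, and (ii) for all $\epsilon\in(0,\infty)$ there is a compact metric space $(Y,e)$ with $\mathcal{D}(Y,e)=\infty$ and $\delta_e(Y)\le\epsilon$. Put $\mathcal{I}(\mathcal{D})=\{(X,d)\in\mathcal{M}:\mathcal{D}(X,d)=\infty\}$. $\mathcal{CA}\subset\mathcal{M}$ is the set of all compact metric spaces homeomorphic to the Cantor set. A metric space $(S,\rho)$ is a geodesic space if for all $x,y\in S$ there is a continuous $\gamma:[0,1]\to S$ with $\gamma(0)=x$, $\gamma(1)=y$ and $\rho(\gamma(s),\gamma(t))=|s-t|\cdot\rho(x,y)$ for all $s,t\in[0,1]$. *)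

theory Defs
  imports "HOL-Analysis.Analysis"
begin

section \<open>Isometries between abstract metric spaces\<close>

definition isometric_embedding :: "'a metric \<Rightarrow> 'b metric \<Rightarrow> ('a \<Rightarrow> 'b) \<Rightarrow> bool" where
  "isometric_embedding m m' f \<longleftrightarrow>
     f ` mspace m \<subseteq> mspace m' \<and>
     (\<forall>x\<in>mspace m. \<forall>y\<in>mspace m. mdist m' (f x) (f y) = mdist m x y)"

definition isometric :: "'a metric \<Rightarrow> 'b metric \<Rightarrow> bool" where
  "isometric m m' \<longleftrightarrow> (\<exists>f. isometric_embedding m m' f \<and> f ` mspace m = mspace m')"

definition compact_metric :: "'a metric \<Rightarrow> bool" where
  "compact_metric m \<longleftrightarrow> compact_space (mtopology_of m) \<and> mspace m \<noteq> {}"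

lemma isometric_embedding_inj:
  assumes "isometric_embedding m m' f"
  shows "inj_on f (mspace m)"
proof (rule inj_onI)
  fix x y assume xy: "x \<in> mspace m" "y \<in> mspace m" "f x = f y"
  then have "mdist m x y = mdist m' (f x) (f x)" "f x \<in> mspace m'"
    using assms unfolding isometric_embedding_def by (metis, blast)
  then have "mdist m x y = 0" by simp
  then show "x = y" using xy(1,2) by (simp add: mdist_zero)
qed

lemma isometric_embedding_comp:
  "isometric_embedding m1 m2 f \<Longrightarrow> isometric_embedding m2 m3 g \<Longrightarrow>
   isometric_embedding m1 m3 (g \<circ> f)"
  unfolding isometric_embedding_def by (auto simp: image_subset_iff)

lemma isometric_refl: "isometric m m"
  unfolding isometric_def isometric_embedding_def by (rule exI[of _ id]) auto

lemma isometric_sym: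
  assumes "isometric m m'"
  shows "isometric m' m"
proof -
  obtain f where f: "isometric_embedding m m' f" "f ` mspace m = mspace m'"
    using assms unfolding isometric_def by blast
  let ?g = "inv_into (mspace m) f"
  have inj: "inj_on f (mspace m)"
    using f(1) by (rule isometric_embedding_inj)
  have img: "?g ` mspace m' = mspace m"
    using inj f(2) by (metis inv_into_image_cancel order_refl)
  moreover have "mdist m (?g x) (?g y) = mdist m' x y"
    if "x \<in> mspace m'" "y \<in> mspace m'" for x y
  proof -
    have "f (?g x) = x" "f (?g y) = y"
      using that f(2) by (auto intro: f_inv_into_f)
    moreover have "?g x \<in> mspace m" "?g y \<in> mspace m"
      using that img by auto
    ultimately show ?thesis
      using f(1) unfolding isometric_embedding_def by metis
  qed
  ultimately have "isometric_embedding m' m ?g"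
    unfolding isometric_embedding_def by auto
  with img show ?thesis
    unfolding isometric_def by blast
qed

lemma isometric_trans:
  assumes "isometric m1 m2" "isometric m2 m3"
  shows "isometric m1 m3"
proof -
  obtain f g where "isometric_embedding m1 m2 f" "f ` mspace m1 = mspace m2"
    "isometric_embedding m2 m3 g" "g ` mspace m2 = mspace m3"
    using assms unfolding isometric_def by blast
  then show ?thesis
    unfolding isometric_def
    by (intro exI[of _ "g \<circ> f"]) (metis image_comp isometric_embedding_comp)
qed

text \<open>Transport of a metric along an injection.\<close>

lemma isometric_transport:
  fixes m :: "'a metric" and h :: "'a \<Rightarrow> 'b"
  assumes inj: "inj_on h (mspace m)"
  obtains m' :: "'b metric"
  where "mspace m' = h ` mspace m" "isometric_embedding m m' h"
proof -
  let ?g = "inv_into (mspace m) h"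
  let ?d = "\<lambda>x y. mdist m (?g x) (?g y)"
  have M: "Metric_space (h ` mspace m) ?d"
  proof
    fix x y assume "x \<in> h ` mspace m" "y \<in> h ` mspace m"
    then show "(?d x y = 0) = (x = y)"
      using inj by (auto simp: inv_into_f_f)
  next
    fix x y z assume "x \<in> h ` mspace m" "y \<in> h ` mspace m" "z \<in> h ` mspace m"
    then show "?d x z \<le> ?d x y + ?d y z"
      using inj by (auto simp: inv_into_f_f intro: mdist_triangle)
  qed (auto simp: mdist_commute)
  have "mspace (metric (h ` mspace m, ?d)) = h ` mspace m"
    "mdist (metric (h ` mspace m, ?d)) = ?d"
    using M by (auto simp: Metric_space.mspace_metric Metric_space.mdist_metric)
  then show ?thesis
    using inj by (intro that[of "metric (h ` mspace m, ?d)"])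
      (auto simp: isometric_embedding_def inv_into_f_f)
qed


section \<open>The space of isometry classes of compact metric spaces\<close>

text \<open>
  HOL cannot collect metric spaces over all types into one set.  A compact metric space has at
  most the cardinality of the continuum, so it is isometric to one whose points are real numbers
  (the metric on them being arbitrary, and unrelated to the usual distance).  Hence the isometry
  classes of nonempty elements of \<^typ>\<open>real metric\<close> represent all isometry classes.
\<close>

lemma compact_metric_lepoll_real:
  assumes "compact_space (mtopology_of (m :: 'a metric))"
  shows "mspace m \<lesssim> (UNIV :: real set)"
proof -
  interpret Metric_space "mspace m" "mdist m" by simp
  have tb: "mtotally_bounded (mspace m)"
    using assms compact_space_eq_mcomplete_mtotally_bounded by (simp add: mtopology_of_def)
  have "\<forall>n::nat. \<exists>K. finite K \<and> K \<subseteq> mspace m \<and> mspace m \<subseteq> (\<Union>x\<in>K. mball x (1 / Suc n))"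
    using tb unfolding mtotally_bounded_def by (metis divide_pos_pos of_nat_0_less_iff zero_less_Suc zero_less_one)
  then obtain K where K: "\<And>n::nat. finite (K n)" "\<And>n. K n \<subseteq> mspace m"
    "\<And>n::nat. mspace m \<subseteq> (\<Union>x\<in>K n. mball x (1 / Suc n))"
    by metis
  define C where "C = (\<Union>n. K n) \<times> (UNIV :: nat set)"
  have "countable C"
    unfolding C_def using K(1) by (auto intro: countable_finite)
  then obtain e :: "'a \<times> nat \<Rightarrow> nat" where e: "inj_on e C"
    unfolding countable_def by blast
  define F where "F x = e ` {(c, n) \<in> C. mdist m c x < 1 / Suc n}" for x
  have "inj_on F (mspace m)"
  proof (rule inj_onI, rule ccontr)
    fix x y assume xy: "x \<in> mspace m" "y \<in> mspace m" "F x = F y" "x \<noteq> y"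
    then have "mdist m x y > 0" by simp
    then have "mdist m x y / 2 > 0" by simp
    then obtain n :: nat where n: "1 / Suc n < mdist m x y / 2"
      using nat_approx_posE by blast
    obtain c where c: "c \<in> K n" "mdist m c x < 1 / Suc n"
      using K(3)[of n] xy(1) by auto
    have eq: "{(c, n) \<in> C. mdist m c x < 1 / Suc n} = {(c, n) \<in> C. mdist m c y < 1 / Suc n}"
      using xy(3) unfolding F_def
      by (subst (asm) inj_on_image_eq_iff[OF e]) auto
    have "(c, n) \<in> C" using c unfolding C_def by auto
    then have "mdist m c y < 1 / Suc n"
      using eq c(2) by blast
    moreover have "mdist m x y \<le> mdist m c x + mdist m c y"
      using triangle'' [of x c y] xy K(2) c by blast
    ultimately show False using n c(2) by linarith
  qed
  then have "mspace m \<lesssim> (UNIV :: nat set set)"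
    unfolding lepoll_def by blast
  then show ?thesis
    using nat_sets_eqpoll_reals lepoll_trans2 by blast
qed

lemma compact_metric_isometric_real:
  fixes m :: "'a metric"
  assumes "compact_space (mtopology_of m)"
  obtains m' :: "real metric" where "isometric m m'"
proof -
  obtain h :: "'a \<Rightarrow> real" where "inj_on h (mspace m)"
    using compact_metric_lepoll_real[OF assms] unfolding lepoll_def by blast
  then obtain m' :: "real metric" where "mspace m' = h ` mspace m" "isometric_embedding m m' h"
    using isometric_transport by blast
  then show ?thesis
    using that unfolding isometric_def by metis
qed

definition isometric_compact :: "real metric \<Rightarrow> real metric \<Rightarrow> bool" where
  "isometric_compact m m' \<longleftrightarrow> compact_metric m \<and> compact_metric m' \<and> isometric m m'"

lemma compact_metric_singleton: "\<exists>m :: real metric. compact_metric m"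
proof
  let ?m = "submetric euclidean_metric {0 :: real}"
  have "mspace ?m = {0}" by simp
  then have "finite (topspace (mtopology_of ?m))" by simp
  then have "compact_space (mtopology_of ?m)"
    unfolding compact_space_def by (simp add: finite_imp_compactin)
  then show "compact_metric ?m"
    by (simp add: compact_metric_def)
qed

quotient_type gh_space = "real metric" / partial: isometric_compact
  morphisms rep_gh_space gh_class
proof (rule part_equivpI)
  show "\<exists>m. isometric_compact m m"
    using compact_metric_singleton isometric_refl unfolding isometric_compact_def by blast
  show "symp isometric_compact"
    unfolding isometric_compact_def by (auto intro!: sympI isometric_sym)
  show "transp isometric_compact"
    unfolding isometric_compact_def by (auto intro!: transpI intro: isometric_trans)
qed

text \<open>Since the quotient is partial, \<^const>\<open>gh_class\<close> is meaningful only on compact spaces.\<close>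

lemma gh_class_eq_iff:
  assumes "compact_metric m" "compact_metric m'"
  shows "gh_class m = gh_class m' \<longleftrightarrow> isometric m m'"
  using Quotient3_gh_space assms isometric_refl
  unfolding isometric_compact_def by (metis (mono_tags, lifting) Quotient3_rel isometric_compact_def)

lemma gh_class_cases:
  obtains m where "compact_metric m" "X = gh_class m"
proof -
  have "isometric_compact (rep_gh_space X) (rep_gh_space X)"
    using Quotient3_gh_space by (rule Quotient3_rep_reflp)
  moreover have "gh_class (rep_gh_space X) = X"
    using Quotient3_gh_space by (rule Quotient3_abs_rep)
  ultimately show ?thesis
    using that unfolding isometric_compact_def by metis
qed


section \<open>The Gromov--Hausdorff distance\<close>

text \<open>Meaningful for nonempty bounded subsets only; it is applied to compact ones.\<close>

definition hausdorff_distance :: "'a metric \<Rightarrow> 'a set \<Rightarrow> 'a set \<Rightarrow> real" where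
  "hausdorff_distance m A B =
     max (SUP a\<in>A. INF b\<in>B. mdist m a b) (SUP b\<in>B. INF a\<in>A. mdist m a b)"

text \<open>
  The ambient space is again taken over \<^typ>\<open>real\<close>, which is no restriction: only the
  union of the two images matters (lemma \<open>gh_distance_le\<close> below).
\<close>

definition gh_distance :: "real metric \<Rightarrow> real metric \<Rightarrow> real" where
  "gh_distance X Y =
     Inf {hausdorff_distance Z (f ` mspace X) (g ` mspace Y) | (Z :: real metric) f g.
            isometric_embedding X Z f \<and> isometric_embedding Y Z g}"

lemma gh_distance_isometric_subset:
  assumes "isometric X X'" "isometric Y Y'"
  shows "{hausdorff_distance Z (f ` mspace X) (g ` mspace Y) | (Z :: real metric) f g.
            isometric_embedding X Z f \<and> isometric_embedding Y Z g}
       \<subseteq> {hausdorff_distance Z (f ` mspace X') (g ` mspace Y') | (Z :: real metric) f g.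
            isometric_embedding X' Z f \<and> isometric_embedding Y' Z g}"
proof -
  obtain h k where h: "isometric_embedding X' X h" "h ` mspace X' = mspace X"
    and k: "isometric_embedding Y' Y k" "k ` mspace Y' = mspace Y"
    using assms[THEN isometric_sym] unfolding isometric_def by blast
  show ?thesis
  proof clarify
    fix Z :: "real metric" and f g
    assume "isometric_embedding X Z f" "isometric_embedding Y Z g"
    then have "isometric_embedding X' Z (f \<circ> h)" "isometric_embedding Y' Z (g \<circ> k)"
      using h(1) k(1) isometric_embedding_comp by blast+
    moreover have "(f \<circ> h) ` mspace X' = f ` mspace X" "(g \<circ> k) ` mspace Y' = g ` mspace Y"
      using h(2) k(2) by (metis image_comp)+
    ultimately show "\<exists>(Z' :: real metric) f' g'. hausdorff_distance Z (f ` mspace X) (g ` mspace Y) =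
        hausdorff_distance Z' (f' ` mspace X') (g' ` mspace Y') \<and>
        isometric_embedding X' Z' f' \<and> isometric_embedding Y' Z' g'"
      by (intro exI[of _ Z] exI[of _ "f \<circ> h"] exI[of _ "g \<circ> k"]) simp
  qed
qed

lemma gh_distance_isometric:
  assumes "isometric X X'" "isometric Y Y'"
  shows "gh_distance X Y = gh_distance X' Y'"
  using gh_distance_isometric_subset[OF assms]
    gh_distance_isometric_subset[OF assms[THEN isometric_sym]]
  unfolding gh_distance_def by (metis (no_types, lifting) subset_antisym)

lift_definition d_GH :: "gh_space \<Rightarrow> gh_space \<Rightarrow> real" is gh_distance
  by (auto simp: isometric_compact_def intro: gh_distance_isometric)

lemma d_GH_gh_class:
  assumes "compact_metric X" "compact_metric Y"
  shows "d_GH (gh_class X) (gh_class Y) = gh_distance X Y"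
  using assms by (intro d_GH.abs_eq) (auto simp: isometric_compact_def isometric_refl)

lemma hausdorff_distance_nonneg:
  assumes "compact_metric X" "compact_metric Y"
    "isometric_embedding X Z f" "isometric_embedding Y Z g"
  shows "0 \<le> hausdorff_distance Z (f ` mspace X) (g ` mspace Y)"
proof -
  let ?A = "f ` mspace X" and ?B = "g ` mspace Y"
  obtain x y where x: "x \<in> mspace X" and y: "y \<in> mspace Y"
    using assms unfolding compact_metric_def by blast
  interpret MX: Metric_space "mspace X" "mdist X" by simp
  have "MX.mbounded (mspace X)"
    using assms(1) MX.compactin_imp_mbounded
    unfolding compact_metric_def compact_space_def by (simp add: mtopology_of_def)
  then obtain b where b: "\<And>x'. x' \<in> mspace X \<Longrightarrow> mdist X x x' \<le> b"
    by (metis MX.mbounded_alt mdist_commute x)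
  have sub: "?A \<subseteq> mspace Z" "?B \<subseteq> mspace Z"
    using assms unfolding isometric_embedding_def by auto
  have bdd: "bdd_below ((\<lambda>b. mdist Z a b) ` ?B)" for a
    by (rule bdd_belowI[of _ 0]) auto
  have "(INF c\<in>?B. mdist Z a c) \<le> b + mdist Z (f x) (g y)" if a: "a \<in> ?A" for a
  proof -
    obtain x' where x': "x' \<in> mspace X" "a = f x'" using a by blast
    have "mdist Z a (g y) \<le> mdist Z a (f x) + mdist Z (f x) (g y)"
      using sub x y a by (intro mdist_triangle) auto
    also have "mdist Z a (f x) = mdist X x x'"
      using assms(3) x x' unfolding isometric_embedding_def by (metis mdist_commute)
    also have "\<dots> \<le> b" using b x' by blast
    finally have "mdist Z a (g y) \<le> b + mdist Z (f x) (g y)" by simp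
    then show ?thesis using y bdd by (meson cINF_lower2 imageI)
  qed
  then have "bdd_above ((\<lambda>a. INF c\<in>?B. mdist Z a c) ` ?A)"
    by (intro bdd_aboveI2)
  moreover have "0 \<le> (INF c\<in>?B. mdist Z (f x) c)"
    using y by (intro cINF_greatest) auto
  ultimately have "0 \<le> (SUP a\<in>?A. INF c\<in>?B. mdist Z a c)"
    using x by (meson cSUP_upper2 imageI)
  then show ?thesis
    unfolding hausdorff_distance_def by simp
qed

lemma gh_distance_le:
  fixes Z :: "'c metric"
  assumes "compact_metric X" "compact_metric Y"
    "isometric_embedding X Z f" "isometric_embedding Y Z g"
  shows "gh_distance X Y \<le> hausdorff_distance Z (f ` mspace X) (g ` mspace Y)"
proof -
  let ?S = "f ` mspace X \<union> g ` mspace Y"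
  have sub: "?S \<subseteq> mspace Z"
    using assms unfolding isometric_embedding_def by auto
  define W where "W = submetric Z ?S"
  have W: "mspace W = ?S" "mdist W = mdist Z"
    using sub unfolding W_def by auto
  have fgW: "isometric_embedding X W f" "isometric_embedding Y W g"
    using assms(3,4) W unfolding isometric_embedding_def by auto
  have "f ` mspace X \<lesssim> (UNIV :: real set)" "g ` mspace Y \<lesssim> (UNIV :: real set)"
    by (meson image_lepoll lepoll_trans subset_UNIV subset_imp_lepoll)+
  moreover have "(UNIV :: real set) \<approx> {0<..<1::real}" "(UNIV :: real set) \<approx> {2<..<3::real}"
    by (auto intro: eqpoll_sym simp: open_interval_eqpoll_reals)
  ultimately have "f ` mspace X \<lesssim> {0<..<1::real}" "g ` mspace Y \<lesssim> {2<..<3::real}"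
    using lepoll_trans2 by blast+
  then have "?S \<lesssim> {0<..<1::real} \<union> {2<..<3::real}"
    by (rule Un_lepoll_mono) (auto simp: disjnt_iff)
  then have "?S \<lesssim> (UNIV :: real set)"
    by (meson lepoll_trans subset_UNIV subset_imp_lepoll)
  then obtain h :: "'c \<Rightarrow> real" where h: "inj_on h ?S"
    unfolding lepoll_def by blast
  obtain V :: "real metric" where V: "mspace V = h ` mspace W" "isometric_embedding W V h"
    using isometric_transport[of h W] h W by auto
  have emb: "isometric_embedding X V (h \<circ> f)" "isometric_embedding Y V (h \<circ> g)"
    using fgW V isometric_embedding_comp by blast+
  have d: "mdist V (h a) (h b) = mdist Z a b" if "a \<in> ?S" "b \<in> ?S" for a b
    using V W that unfolding isometric_embedding_def by auto
  have eq: "hausdorff_distance V ((h \<circ> f) ` mspace X) ((h \<circ> g) ` mspace Y)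
      = hausdorff_distance Z (f ` mspace X) (g ` mspace Y)"
    unfolding hausdorff_distance_def image_image comp_def
    using d by simp
  have "gh_distance X Y \<le> hausdorff_distance V ((h \<circ> f) ` mspace X) ((h \<circ> g) ` mspace Y)"
    unfolding gh_distance_def
  proof (rule cInf_lower)
    show "bdd_below {hausdorff_distance Z (f ` mspace X) (g ` mspace Y) | (Z :: real metric) f g.
            isometric_embedding X Z f \<and> isometric_embedding Y Z g}"
      using hausdorff_distance_nonneg[OF assms(1,2)] by (intro bdd_belowI[of _ 0]) auto
  qed (use emb in blast)
  then show ?thesis using eq by simp
qed


section \<open>Dimensional functions, Cantor metric spaces, geodesic spaces\<close>

definition mdiameter :: "'a metric \<Rightarrow> real" where
  "mdiameter m = (SUP (x, y)\<in>mspace m \<times> mspace m. mdist m x y)"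

definition dimensional_function :: "(gh_space \<Rightarrow> ennreal) \<Rightarrow> bool" where
  "dimensional_function D \<longleftrightarrow>
     (\<forall>X A. compact_metric X \<longrightarrow> closedin (mtopology_of X) A \<longrightarrow> A \<noteq> {} \<longrightarrow>
        D (gh_class (submetric X A)) \<le> D (gh_class X)) \<and>
     (\<forall>\<epsilon>>0. \<exists>Y. compact_metric Y \<and> D (gh_class Y) = \<infinity> \<and> mdiameter Y \<le> \<epsilon>)"

definition infinite_dimensional :: "(gh_space \<Rightarrow> ennreal) \<Rightarrow> gh_space set" where
  "infinite_dimensional D = {X. D X = \<infinity>}"

text \<open>The middle-thirds Cantor set: the reals with a ternary expansion using digits 0 and 2 only.\<close>

definition cantor_set :: "real set" where
  "cantor_set = range (\<lambda>a :: nat \<Rightarrow> bool. \<Sum>n. (if a n then 2 else 0) / 3 ^ Suc n)"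

definition cantor_metric_spaces :: "gh_space set" where
  "cantor_metric_spaces =
     gh_class ` {X. compact_metric X \<and> mtopology_of X homeomorphic_space top_of_set cantor_set}"

definition geodesic_space :: "'a set \<Rightarrow> ('a \<Rightarrow> 'a \<Rightarrow> real) \<Rightarrow> bool" where
  "geodesic_space S \<rho> \<longleftrightarrow>
     Metric_space S \<rho> \<and>
     (\<forall>x\<in>S. \<forall>y\<in>S. \<exists>\<gamma>.
        continuous_map (top_of_set {0..1::real}) (Metric_space.mtopology S \<rho>) \<gamma> \<and>
        \<gamma> 0 = x \<and> \<gamma> 1 = y \<and>
        (\<forall>s\<in>{0..1}. \<forall>t\<in>{0..1}. \<rho> (\<gamma> s) (\<gamma> t) = \<bar>s - t\<bar> * \<rho> x y))"

end

theory Submission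
  imports Defs
begin

text \<open>
  Two compact spaces at Gromov--Hausdorff distance \<open>r\<close> are related by a closed correspondence \<open>R\<close>
  of distortion \<open>2 * r\<close> (Tychonoff's theorem applied to the metrics on the disjoint union), and
  \<open>t \<mapsto> (R, (1 - t) * d\<^sub>X + t * d\<^sub>Y)\<close> is the standard geodesic between them.  To stay in the
  given class, replace \<open>R\<close> by \<open>R \<times> W\<close> and this metric by its maximum with
  \<open>min d\<^sub>W (2 * r * min t (1 - t))\<close>.  The second term is \<open>2 * r\<close>-Lipschitz in \<open>t\<close>, so the path is
  still a geodesic, and it vanishes at the end points.  For a dimensional function, \<open>W\<close> is a bouquet
  of arbitrarily small spaces of infinite dimension, and at every interior time some of them are
  smaller than the truncation threshold and hence embedded isometrically.  For Cantor spaces, \<open>W\<close> is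
  one of the two end points: the interior spaces then have countably many clopen sets separating
  points and no isolated points, so Brouwer's characterisation of the Cantor set applies.
\<close>

section \<open>Compact metric spaces\<close>

text \<open>The plain interpolation may leave the class. Its interior metrics need not contain an
  isometric copy of \<open>X\<close> or \<open>Y\<close>, while a dimensional function is monotone
  only for closed subsets with the inherited metric; in the Cantor case nothing in the construction
  excludes isolated points of \<open>R\<close>. A third factor cures both, but under a strict
  budget: between times \<open>s\<close> and \<open>t\<close> a distortion of at most
  \<open>2 * r * \<bar>s - t\<bar>\<close> is allowed. The interpolation alone may use up this
  budget, hence the maximum of the two terms and not their sum. The height
  \<open>2 * r * min t (1 - t)\<close> is the largest one of slope at most \<open>2 * r\<close> that
  vanishes at both ends. The factor is truncated and not rescaled because nothing relates
  \<open>D\<close> of a space to \<open>D\<close> of its rescaled copies: small subspaces of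
  \<open>W\<close> have to survive with exactly their own metric. Only upper bounds on the distances
  along the path need proof; as the ends are at distance \<open>r\<close>, the triangle inequality
  turns them into equalities.\<close>

lemma compact_metric_seq:
  assumes "compact_metric X" "\<And>k::nat. \<sigma> k \<in> mspace X"
  obtains l r where "l \<in> mspace X" "strict_mono (r :: nat \<Rightarrow> nat)"
    "(\<lambda>k. mdist X (\<sigma> (r k)) l) \<longlonglongrightarrow> 0"
proof -
  interpret Metric_space "mspace X" "mdist X" by simp
  obtain l r where "l \<in> mspace X" "strict_mono (r :: nat \<Rightarrow> nat)"
    "limitin mtopology (\<sigma> \<circ> r) l sequentially"
    using assms compact_space_sequentially
    unfolding compact_metric_def mtopology_of_def by (metis image_subset_iff)
  then show ?thesis
    using that by (simp add: limitin_metric_dist_null)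
qed

lemma compact_metric_seqI:
  assumes "mspace X \<noteq> {}"
    and seq: "\<And>\<sigma> :: nat \<Rightarrow> 'a. (\<And>k. \<sigma> k \<in> mspace X) \<Longrightarrow>
      \<exists>l r. l \<in> mspace X \<and> strict_mono (r :: nat \<Rightarrow> nat) \<and> (\<lambda>k. mdist X (\<sigma> (r k)) l) \<longlonglongrightarrow> 0"
  shows "compact_metric X"
proof -
  interpret Metric_space "mspace X" "mdist X" by simp
  have "\<exists>l r. l \<in> mspace X \<and> strict_mono r \<and> limitin mtopology (\<sigma> \<circ> r) l sequentially"
    if "range \<sigma> \<subseteq> mspace X" for \<sigma> :: "nat \<Rightarrow> 'a"
  proof -
    have "\<sigma> k \<in> mspace X" for k using that by auto
    with seq[of \<sigma>] show ?thesis by (auto simp: limitin_metric_dist_null comp_def)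
  qed
  then show ?thesis
    using assms(1) compact_space_sequentially by (simp add: compact_metric_def mtopology_of_def)
qed

lemma compact_metric_bounded:
  assumes "compact_metric X"
  obtains C where "C > 0" "\<And>x y. x \<in> mspace X \<Longrightarrow> y \<in> mspace X \<Longrightarrow> mdist X x y \<le> C"
proof -
  interpret Metric_space "mspace X" "mdist X" by simp
  have "mbounded (mspace X)"
    using assms compactin_imp_mbounded
    unfolding compact_metric_def compact_space_def by (simp add: mtopology_of_def)
  then obtain C where "C > 0" "\<forall>x\<in>mspace X. \<forall>y\<in>mspace X. mdist X x y \<le> C"
    unfolding mbounded_alt_pos by blast
  then show ?thesis using that by blast
qed

lemma compact_metric_net:
  assumes "compact_metric X" "\<epsilon> > 0"
  obtains N where "finite N" "N \<subseteq> mspace X" "\<And>x. x \<in> mspace X \<Longrightarrow> \<exists>y\<in>N. mdist X x y < \<epsilon>"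
proof -
  interpret Metric_space "mspace X" "mdist X" by simp
  have "mtotally_bounded (mspace X)"
    using assms compact_space_eq_mcomplete_mtotally_bounded
    by (simp add: compact_metric_def mtopology_of_def)
  then obtain N where N: "finite N" "N \<subseteq> mspace X" "mspace X \<subseteq> (\<Union>x\<in>N. mball x \<epsilon>)"
    using assms(2) unfolding mtotally_bounded_def by meson
  show ?thesis
  proof (rule that[OF N(1,2)])
    fix x assume "x \<in> mspace X"
    then obtain y where "y \<in> N" "x \<in> mball y \<epsilon>" using N(3) by blast
    then show "\<exists>y\<in>N. mdist X x y < \<epsilon>" by (auto simp: mdist_commute)
  qed
qed

lemma mdist_triangle2:
  assumes "a \<in> mspace m" "b \<in> mspace m" "c \<in> mspace m" "d \<in> mspace m"
  shows "mdist m a b \<le> mdist m a c + mdist m c d + mdist m d b"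
  using assms mdist_triangle[of a m c b] mdist_triangle[of c m d b] by linarith


section \<open>Correspondences and the Gromov--Hausdorff distance\<close>

text \<open>Closedness is kept apart, in \<open>closed_relation\<close>: upper bounds for the
  distance use the distortion alone, whereas compactness of the interpolating spaces needs a closed
  relation.\<close>

definition correspondence :: "'a metric \<Rightarrow> 'b metric \<Rightarrow> real \<Rightarrow> ('a \<times> 'b) set \<Rightarrow> bool" where
  "correspondence X Y c R \<longleftrightarrow>
     R \<subseteq> mspace X \<times> mspace Y \<and> fst ` R = mspace X \<and> snd ` R = mspace Y \<and>
     (\<forall>(x, y)\<in>R. \<forall>(x', y')\<in>R. \<bar>mdist X x x' - mdist Y y y'\<bar> \<le> c)"

lemma correspondence_mono:
  "correspondence X Y c R \<Longrightarrow> c \<le> c' \<Longrightarrow> correspondence X Y c' R"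
  unfolding correspondence_def by (blast intro: order_trans)

lemma correspondence_distortion:
  assumes "correspondence X Y c R" "(x, y) \<in> R" "(x', y') \<in> R"
  shows "\<bar>mdist X x x' - mdist Y y y'\<bar> \<le> c"
proof -
  have "\<forall>(x, y)\<in>R. \<forall>(x', y')\<in>R. \<bar>mdist X x x' - mdist Y y y'\<bar> \<le> c"
    using assms(1) unfolding correspondence_def by blast
  from bspec[OF this assms(2)] assms(3) show ?thesis by auto
qed

lemma correspondence_left:
  assumes "correspondence X Y c R" "x \<in> mspace X"
  obtains y where "(x, y) \<in> R" "y \<in> mspace Y"
proof -
  have "x \<in> fst ` R" "R \<subseteq> mspace X \<times> mspace Y"
    using assms unfolding correspondence_def by auto
  then show ?thesis using that by auto
qed

lemma correspondence_right:
  assumes "correspondence X Y c R" "y \<in> mspace Y"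
  obtains x where "(x, y) \<in> R" "x \<in> mspace X"
proof -
  have "y \<in> snd ` R" "R \<subseteq> mspace X \<times> mspace Y"
    using assms unfolding correspondence_def by auto
  then show ?thesis using that by auto
qed

section \<open>Hausdorff distance estimates and gluing along a correspondence\<close>

lemma hausdorff_distance_le:
  assumes "A \<noteq> {}" "B \<noteq> {}"
    and "\<And>a. a \<in> A \<Longrightarrow> \<exists>b\<in>B. mdist Z a b \<le> \<rho>" "\<And>b. b \<in> B \<Longrightarrow> \<exists>a\<in>A. mdist Z a b \<le> \<rho>"
  shows "hausdorff_distance Z A B \<le> \<rho>"
proof -
  have bb: "bdd_below (h ` C)" if "\<And>c. 0 \<le> h c" for h :: "'a \<Rightarrow> real" and C
    using that by (intro bdd_belowI[of _ 0]) auto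
  have "(INF b\<in>B. mdist Z a b) \<le> \<rho>" if "a \<in> A" for a
    using assms(3)[OF that] bb by (meson cINF_lower2 mdist_nonneg)
  moreover have "(INF a\<in>A. mdist Z a b) \<le> \<rho>" if "b \<in> B" for b
    using assms(4)[OF that] bb by (meson cINF_lower2 mdist_nonneg)
  ultimately show ?thesis
    unfolding hausdorff_distance_def using assms(1,2) by (simp add: cSUP_least)
qed

text \<open>The bound \<open>C\<close> keeps the suprema meaningful, since \<open>SUP\<close> of an
  unbounded set of reals carries no information. The inequality is strict because the infima need
  not be attained.\<close>

lemma hausdorff_distance_less_imp:
  assumes "hausdorff_distance Z A B < \<delta>" "A \<noteq> {}" "B \<noteq> {}"
    and bdd: "\<And>a b. a \<in> A \<Longrightarrow> b \<in> B \<Longrightarrow> mdist Z a b \<le> C"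
  shows "a \<in> A \<Longrightarrow> \<exists>b\<in>B. mdist Z a b < \<delta>" and "b \<in> B \<Longrightarrow> \<exists>a\<in>A. mdist Z a b < \<delta>"
proof -
  have bb: "bdd_below (h ` C)" if "\<And>c. 0 \<le> h c" for h :: "'a \<Rightarrow> real" and C
    using that by (intro bdd_belowI[of _ 0]) auto
  have "(INF b\<in>B. mdist Z a b) \<le> C" if "a \<in> A" for a
    using bdd that assms(3) bb by (meson all_not_in_conv cINF_lower2 mdist_nonneg)
  then have 1: "bdd_above ((\<lambda>a. INF b\<in>B. mdist Z a b) ` A)"
    by (intro bdd_aboveI2)
  have "(INF a\<in>A. mdist Z a b) \<le> C" if "b \<in> B" for b
    using bdd that assms(2) bb by (meson all_not_in_conv cINF_lower2 mdist_nonneg)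
  then have 2: "bdd_above ((\<lambda>b. INF a\<in>A. mdist Z a b) ` B)"
    by (intro bdd_aboveI2)
  show "\<exists>b\<in>B. mdist Z a b < \<delta>" if "a \<in> A"
  proof -
    have "(INF b\<in>B. mdist Z a b) < \<delta>"
      using cSUP_upper[OF that 1] assms(1) unfolding hausdorff_distance_def by simp
    then show ?thesis
      using assms(3) bb by (subst (asm) cINF_less_iff) auto
  qed
  show "\<exists>a\<in>A. mdist Z a b < \<delta>" if "b \<in> B"
  proof -
    have "(INF a\<in>A. mdist Z a b) < \<delta>"
      using cSUP_upper[OF that 2] assms(1) unfolding hausdorff_distance_def by simp
    then show ?thesis
      using assms(2) bb by (subst (asm) cINF_less_iff) auto
  qed
qed

text \<open>The two spaces are glued along the correspondence with bridges of length \<open>\<rho>\<close>.\<close>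

lemma correspondence_imp_common_space:
  fixes X :: "'a metric" and Y :: "'b metric"
  assumes R: "correspondence X Y (2 * \<rho>) R" and "R \<noteq> {}" and "\<rho> > 0"
  obtains Z :: "('a + 'b) metric"
  where "isometric_embedding X Z Inl" "isometric_embedding Y Z Inr"
    "\<And>x y. (x, y) \<in> R \<Longrightarrow> mdist Z (Inl x) (Inr y) \<le> \<rho>"
proof -
  \<comment> \<open>Length of a shortest route from \<open>x\<close> to \<open>y\<close> that
    crosses a single bridge, from \<open>fst p\<close> to \<open>snd p\<close> for some pair
    \<open>p\<close> of \<open>R\<close>.\<close>
  define br where "br x y = (INF p\<in>R. mdist X x (fst p) + \<rho> + mdist Y (snd p) y)" for x y
  have bdd: "bdd_below ((\<lambda>p. mdist X x (fst p) + \<rho> + mdist Y (snd p) y) ` R)" for x y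
    using assms(3) by (intro bdd_belowI[of _ 0]) (auto intro!: add_nonneg_nonneg)
  have br_le: "br x y \<le> mdist X x x' + \<rho> + mdist Y y' y" if "(x', y') \<in> R" for x y x' y'
    using cINF_lower[OF bdd that, of x y] unfolding br_def by simp
  have br_ge: "c \<le> br x y"
    if "\<And>x' y'. (x', y') \<in> R \<Longrightarrow> c \<le> mdist X x x' + \<rho> + mdist Y y' y" for c x y
    unfolding br_def using assms(2) that by (intro cINF_greatest) auto
  have br_pos: "\<rho> \<le> br x y" for x y
    by (rule br_ge) simp
  have RX: "x \<in> mspace X" and RY: "y \<in> mspace Y" if "(x, y) \<in> R" for x y
    using R that unfolding correspondence_def by auto
  have dis: "\<bar>mdist X x x' - mdist Y y y'\<bar> \<le> 2 * \<rho>" if "(x, y) \<in> R" "(x', y') \<in> R" for x y x' y'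
    using R that unfolding correspondence_def by auto
  have brX: "br x y \<le> mdist X x x2 + br x2 y" if "x \<in> mspace X" "x2 \<in> mspace X" for x x2 y
  proof -
    have "br x y - mdist X x x2 \<le> br x2 y"
    proof (rule br_ge)
      fix x' y' assume p: "(x', y') \<in> R"
      then show "br x y - mdist X x x2 \<le> mdist X x2 x' + \<rho> + mdist Y y' y"
        using br_le[OF p, of x y] mdist_triangle[of x X x2 x'] RX[OF p] that by linarith
    qed
    then show ?thesis by simp
  qed
  have brY: "br x y \<le> br x y2 + mdist Y y2 y" if "y \<in> mspace Y" "y2 \<in> mspace Y" for x y y2
  proof -
    have "br x y - mdist Y y2 y \<le> br x y2"
    proof (rule br_ge)
      fix x' y' assume p: "(x', y') \<in> R"
      then show "br x y - mdist Y y2 y \<le> mdist X x x' + \<rho> + mdist Y y' y2"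
        using br_le[OF p, of x y] mdist_triangle[of y' Y y2 y] RY[OF p] that by linarith
    qed
    then show ?thesis by simp
  qed
  \<comment> \<open>The origin of the factor 2: a detour from \<open>x\<close> to \<open>x2\<close>
    through \<open>y\<close> crosses two bridges, and their total length \<open>2 * \<rho>\<close>
    pays exactly for the distortion between the two pairs used.\<close>
  have brXX: "mdist X x x2 \<le> br x y + br x2 y"
    if "x \<in> mspace X" "x2 \<in> mspace X" "y \<in> mspace Y" for x x2 y
  proof -
    have "mdist X x x2 - br x2 y \<le> br x y"
    proof (rule br_ge)
      fix a b assume p: "(a, b) \<in> R"
      have "mdist X x x2 - (mdist X x a + \<rho> + mdist Y b y) \<le> br x2 y"
      proof (rule br_ge)
        fix a' b' assume q: "(a', b') \<in> R"
        have "mdist X x x2 \<le> mdist X x a + mdist X a a' + mdist X a' x2"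
          using that RX p q by (intro mdist_triangle2) auto
        moreover have "mdist Y b b' \<le> mdist Y b y + mdist Y b' y"
          using that RY p q mdist_triangle[of b Y y b'] by (auto simp: mdist_commute)
        ultimately show "mdist X x x2 - (mdist X x a + \<rho> + mdist Y b y)
            \<le> mdist X x2 a' + \<rho> + mdist Y b' y"
          using dis[OF p q] mdist_commute[of X x2 a'] by linarith
      qed
      then show "mdist X x x2 - br x2 y \<le> mdist X x a + \<rho> + mdist Y b y" by linarith
    qed
    then show ?thesis by simp
  qed
  have brYY: "mdist Y y y2 \<le> br x y + br x y2"
    if "y \<in> mspace Y" "y2 \<in> mspace Y" "x \<in> mspace X" for x y y2
  proof -
    have "mdist Y y y2 - br x y2 \<le> br x y"
    proof (rule br_ge)
      fix a b assume p: "(a, b) \<in> R"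
      have "mdist Y y y2 - (mdist X x a + \<rho> + mdist Y b y) \<le> br x y2"
      proof (rule br_ge)
        fix a' b' assume q: "(a', b') \<in> R"
        have "mdist Y y y2 \<le> mdist Y y b + mdist Y b b' + mdist Y b' y2"
          using that RY p q by (intro mdist_triangle2) auto
        moreover have "mdist X a a' \<le> mdist X x a + mdist X x a'"
          using that RX p q mdist_triangle[of a X x a'] by (auto simp: mdist_commute)
        ultimately show "mdist Y y y2 - (mdist X x a + \<rho> + mdist Y b y)
            \<le> mdist X x a' + \<rho> + mdist Y b' y2"
          using dis[OF p q] mdist_commute[of Y y b] by linarith
      qed
      then show "mdist Y y y2 - br x y2 \<le> mdist X x a + \<rho> + mdist Y b y" by linarith
    qed
    then show ?thesis by simp
  qed
  define d where "d z w = (case z of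
      Inl x \<Rightarrow> (case w of Inl x' \<Rightarrow> mdist X x x' | Inr y \<Rightarrow> br x y)
    | Inr y \<Rightarrow> (case w of Inl x \<Rightarrow> br x y | Inr y' \<Rightarrow> mdist Y y y'))" for z w
  let ?M = "Inl ` mspace X \<union> Inr ` mspace Y"
  have nn: "0 \<le> br x y" for x y using br_pos[of x y] assms(3) by linarith
  have nz: "br x y \<noteq> 0" for x y using br_pos[of x y] assms(3) by linarith
  interpret Z: Metric_space ?M d
  proof
    fix z w assume "z \<in> ?M" "w \<in> ?M"
    then show "(d z w = 0) = (z = w)"
      unfolding d_def by (auto simp: nz split: sum.splits)
  next
    fix x y z assume *: "x \<in> ?M" "y \<in> ?M" "z \<in> ?M"
    show "d x z \<le> d x y + d y z"
    proof (cases x; cases y; cases z)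
      fix a b c assume "x = Inl a" "y = Inl b" "z = Inl c"
      then show ?thesis using * by (auto simp: d_def intro: mdist_triangle)
    next
      fix a b c assume "x = Inl a" "y = Inl b" "z = Inr c"
      then show ?thesis using * by (auto simp: d_def intro: brX)
    next
      fix a b c assume "x = Inl a" "y = Inr b" "z = Inl c"
      then show ?thesis using * by (auto simp: d_def intro: brXX)
    next
      fix a b c assume "x = Inl a" "y = Inr b" "z = Inr c"
      then show ?thesis using * by (auto simp: d_def intro: brY)
    next
      fix a b c assume "x = Inr a" "y = Inl b" "z = Inl c"
      then show ?thesis using * brX[of c b a] by (auto simp: d_def mdist_commute)
    next
      fix a b c assume "x = Inr a" "y = Inl b" "z = Inr c"
      then show ?thesis using * by (auto simp: d_def intro: brYY)
    next
      fix a b c assume "x = Inr a" "y = Inr b" "z = Inl c"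
      then show ?thesis using * brY[of a b c] by (auto simp: d_def mdist_commute)
    next
      fix a b c assume "x = Inr a" "y = Inr b" "z = Inr c"
      then show ?thesis using * by (auto simp: d_def intro: mdist_triangle)
    qed
  qed (auto simp: d_def mdist_commute nn split: sum.splits)
  show ?thesis
  proof (rule that[of "metric (?M, d)"])
    show "isometric_embedding X (metric (?M, d)) Inl" "isometric_embedding Y (metric (?M, d)) Inr"
      by (auto simp: isometric_embedding_def d_def)
    show "mdist (metric (?M, d)) (Inl x) (Inr y) \<le> \<rho>" if "(x, y) \<in> R" for x y
    proof -
      have "mdist X x x = 0" "mdist Y y y = 0" using RX[OF that] RY[OF that] by simp_all
      then show ?thesis using br_le[OF that, of x y] by (simp add: d_def)
    qed
  qed
qed

lemma correspondence_nonempty: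
  "correspondence X Y c R \<Longrightarrow> compact_metric X \<Longrightarrow> R \<noteq> {}"
  unfolding correspondence_def compact_metric_def by auto

text \<open>Bridges of length 0 would violate definiteness of the glued metric, and
  \<open>\<rho> = 0\<close> has to be allowed in order to recognise isometric spaces. Hence bridges
  of length \<open>\<rho> + e\<close> with \<open>e\<close> tending to 0. That \<open>\<rho>\<close>
  is not negative follows by comparing a pair of \<open>R\<close> with itself.\<close>

lemma gh_distance_le_correspondence:
  assumes X: "compact_metric X" and Y: "compact_metric Y"
    and R: "correspondence X Y (2 * \<rho>) R"
  shows "gh_distance X Y \<le> \<rho>"
proof (rule field_le_epsilon)
  fix e :: real assume "e > 0"
  have ne: "R \<noteq> {}" using correspondence_nonempty[OF R X] .
  then obtain x y where "(x, y) \<in> R" by auto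
  then have "\<bar>mdist X x x - mdist Y y y\<bar> \<le> 2 * \<rho>"
    using correspondence_distortion[OF R] by blast
  then have "\<rho> + e > 0" using \<open>e > 0\<close> by linarith
  moreover have "correspondence X Y (2 * (\<rho> + e)) R"
    using correspondence_mono[OF R] \<open>e > 0\<close> by simp
  ultimately obtain Z :: "(real + real) metric" where Z:
    "isometric_embedding X Z Inl" "isometric_embedding Y Z Inr"
    "\<And>x y. (x, y) \<in> R \<Longrightarrow> mdist Z (Inl x) (Inr y) \<le> \<rho> + e"
    using correspondence_imp_common_space ne by metis
  have "gh_distance X Y \<le> hausdorff_distance Z (Inl ` mspace X) (Inr ` mspace Y)"
    using gh_distance_le[OF X Y Z(1,2)] .
  also have "\<dots> \<le> \<rho> + e"
  proof (rule hausdorff_distance_le)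
    show "\<exists>b\<in>Inr ` mspace Y. mdist Z a b \<le> \<rho> + e" if aa: "a \<in> Inl ` mspace X" for a
    proof -
      obtain x where x: "a = Inl x" "x \<in> mspace X" using aa by auto
      obtain y where "(x, y) \<in> R" "y \<in> mspace Y"
        using correspondence_left[OF R x(2)] .
      then show ?thesis using Z(3) x by blast
    qed
    show "\<exists>a\<in>Inl ` mspace X. mdist Z a b \<le> \<rho> + e" if bb: "b \<in> Inr ` mspace Y" for b
    proof -
      obtain y where y: "b = Inr y" "y \<in> mspace Y" using bb by auto
      obtain x where "(x, y) \<in> R" "x \<in> mspace X"
        using correspondence_right[OF R y(2)] .
      then show ?thesis using Z(3) y by blast
    qed
  qed (use X Y in \<open>auto simp: compact_metric_def\<close>)
  finally show "gh_distance X Y \<le> \<rho> + e" .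
qed

text \<open>Shows that the infimum defining \<open>gh_distance\<close> is taken over a nonempty set.
  The full product is a correspondence whose distortion is controlled by the two diameters.\<close>

lemma common_space_exists:
  fixes X Y :: "real metric"
  assumes X: "compact_metric X" and Y: "compact_metric Y"
  shows "\<exists>(Z :: real metric) f g. isometric_embedding X Z f \<and> isometric_embedding Y Z g"
proof -
  obtain A where A: "A > 0" "\<And>x y. x \<in> mspace X \<Longrightarrow> y \<in> mspace X \<Longrightarrow> mdist X x y \<le> A"
    using compact_metric_bounded[OF X] by metis
  obtain B where B: "B > 0" "\<And>x y. x \<in> mspace Y \<Longrightarrow> y \<in> mspace Y \<Longrightarrow> mdist Y x y \<le> B"
    using compact_metric_bounded[OF Y] by metis
  have "mspace X \<times> mspace Y \<noteq> {}" using X Y by (auto simp: compact_metric_def)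
  moreover have "correspondence X Y (2 * (A + B)) (mspace X \<times> mspace Y)"
  proof -
    have "\<bar>mdist X x x' - mdist Y y y'\<bar> \<le> 2 * (A + B)"
      if "x \<in> mspace X" "x' \<in> mspace X" "y \<in> mspace Y" "y' \<in> mspace Y" for x x' y y'
      using A(2)[OF that(1,2)] B(2)[OF that(3,4)] A(1) B(1) mdist_nonneg[of X x x']
        mdist_nonneg[of Y y y'] unfolding distrib_left by linarith
    moreover have "mspace X \<noteq> {}" "mspace Y \<noteq> {}" using X Y by (auto simp: compact_metric_def)
    ultimately show ?thesis by (auto simp: correspondence_def)
  qed
  ultimately obtain Z :: "(real + real) metric" where Z:
    "isometric_embedding X Z Inl" "isometric_embedding Y Z Inr"
    using correspondence_imp_common_space A(1) B(1) by (metis add_pos_pos)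
  \<comment> \<open>\<open>exp\<close> and its negative map the two summands onto disjoint
    half-lines, which moves the glued space onto real points.\<close>
  have "exp a \<noteq> - exp b" for a b :: real
    using exp_gt_zero[of a] exp_gt_zero[of b] by linarith
  then have "inj (case_sum exp (\<lambda>y. - exp y) :: real + real \<Rightarrow> real)"
    by (intro injI) (auto split: sum.splits, metis)
  then obtain h :: "real + real \<Rightarrow> real" where "inj_on h (mspace Z)"
    using inj_on_subset by blast
  then obtain Z' :: "real metric" where "isometric_embedding Z Z' h"
    using isometric_transport by blast
  then show ?thesis
    using Z isometric_embedding_comp by blast
qed

lemma gh_distance_nonneg:
  assumes "compact_metric X" "compact_metric Y"
  shows "0 \<le> gh_distance X Y"
  unfolding gh_distance_def
proof (rule cInf_greatest)
  show "{hausdorff_distance Z (f ` mspace X) (g ` mspace Y) | (Z :: real metric) f g.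
            isometric_embedding X Z f \<and> isometric_embedding Y Z g} \<noteq> {}"
    using common_space_exists[OF assms] by blast
qed (use hausdorff_distance_nonneg[OF assms] in blast)

text \<open>\<open>u\<close> is the mixed block of a pseudometric on the disjoint union of
  \<open>X\<close> and \<open>Y\<close>; the four inequalities are the triangle inequalities that
  involve points of both spaces. The two blocks inside \<open>X\<close> and \<open>Y\<close> are
  fixed, so only \<open>u\<close> varies and compactness can be sought in a space of functions on
  pairs.\<close>

definition coupling :: "'a metric \<Rightarrow> 'b metric \<Rightarrow> ('a \<times> 'b \<Rightarrow> real) \<Rightarrow> bool" where
  "coupling X Y u \<longleftrightarrow>
     (\<forall>x\<in>mspace X. \<forall>x'\<in>mspace X. \<forall>y\<in>mspace Y. \<forall>y'\<in>mspace Y.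
        u (x, y) \<le> mdist X x x' + u (x', y) \<and>
        u (x, y) \<le> u (x, y') + mdist Y y' y \<and>
        mdist X x x' \<le> u (x, y) + u (x', y) \<and>
        mdist Y y y' \<le> u (x, y) + u (x, y'))"

lemma couplingD:
  assumes "coupling X Y u" "x \<in> mspace X" "x' \<in> mspace X" "y \<in> mspace Y" "y' \<in> mspace Y"
  shows "u (x, y) \<le> mdist X x x' + u (x', y)"
    and "u (x, y) \<le> u (x, y') + mdist Y y' y"
    and "mdist X x x' \<le> u (x, y) + u (x', y)"
    and "mdist Y y y' \<le> u (x, y) + u (x, y')"
  using assms unfolding coupling_def by metis+

text \<open>Each condition is a non-strict inequality between finitely many coordinates of
  \<open>u\<close>, hence closed for pointwise convergence.\<close>

lemma closed_coupling: "closed {u. coupling X Y u}"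
  unfolding coupling_def Ball_def
  by (intro closed_Collect_all closed_Collect_imp closed_Collect_conj closed_Collect_le
      open_Collect_const continuous_intros continuous_on_product_coordinates)

lemma near_optimal_coupling:
  assumes X: "compact_metric X" and Y: "compact_metric Y" and h: "gh_distance X Y < h"
  obtains u where "coupling X Y u"
    "\<And>x. x \<in> mspace X \<Longrightarrow> \<exists>y\<in>mspace Y. u (x, y) < h"
    "\<And>y. y \<in> mspace Y \<Longrightarrow> \<exists>x\<in>mspace X. u (x, y) < h"
    "\<And>p. p \<in> mspace X \<times> mspace Y \<Longrightarrow> 0 \<le> u p"
    "\<And>p. p \<notin> mspace X \<times> mspace Y \<Longrightarrow> u p = 0"
proof -
  let ?S = "{hausdorff_distance Z (f ` mspace X) (g ` mspace Y) | (Z :: real metric) f g.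
            isometric_embedding X Z f \<and> isometric_embedding Y Z g}"
  have "?S \<noteq> {}" using common_space_exists[OF X Y] by blast
  then obtain s where "s \<in> ?S" "s < h"
    using cInf_lessD[of ?S h] h unfolding gh_distance_def by blast
  then obtain Z :: "real metric" and f g where
    Z: "isometric_embedding X Z f" "isometric_embedding Y Z g"
    and hd: "hausdorff_distance Z (f ` mspace X) (g ` mspace Y) < h"
    by blast
  have fm: "f x \<in> mspace Z" if "x \<in> mspace X" for x
    using Z that unfolding isometric_embedding_def by blast
  have gm: "g y \<in> mspace Z" if "y \<in> mspace Y" for y
    using Z that unfolding isometric_embedding_def by blast
  have fd: "mdist Z (f x) (f x') = mdist X x x'" if "x \<in> mspace X" "x' \<in> mspace X" for x x'
    using Z that unfolding isometric_embedding_def by blast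
  have gd: "mdist Z (g y) (g y') = mdist Y y y'" if "y \<in> mspace Y" "y' \<in> mspace Y" for y y'
    using Z that unfolding isometric_embedding_def by blast
  obtain A where A: "\<And>x y. x \<in> mspace X \<Longrightarrow> y \<in> mspace X \<Longrightarrow> mdist X x y \<le> A"
    using compact_metric_bounded[OF X] by metis
  obtain B where B: "\<And>x y. x \<in> mspace Y \<Longrightarrow> y \<in> mspace Y \<Longrightarrow> mdist Y x y \<le> B"
    using compact_metric_bounded[OF Y] by metis
  obtain x0 y0 where x0: "x0 \<in> mspace X" and y0: "y0 \<in> mspace Y"
    using X Y unfolding compact_metric_def by blast
  have C: "mdist Z a b \<le> A + mdist Z (f x0) (g y0) + B"
    if "a \<in> f ` mspace X" "b \<in> g ` mspace Y" for a b
  proof -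
    obtain x y where xy: "a = f x" "b = g y" "x \<in> mspace X" "y \<in> mspace Y"
      using \<open>a \<in> f ` mspace X\<close> \<open>b \<in> g ` mspace Y\<close> by blast
    have "mdist Z a b \<le> mdist Z a (f x0) + mdist Z (f x0) (g y0) + mdist Z (g y0) b"
      using xy fm gm x0 y0 by (intro mdist_triangle2) auto
    then show ?thesis
      using xy fd gd A[of x x0] B[of y0 y] x0 y0 by simp
  qed
  \<comment> \<open>The value 0 outside the product places \<open>u\<close> in a box indexed by all
    pairs of reals, as Tychonoff's theorem will require.\<close>
  define u where "u p = (if p \<in> mspace X \<times> mspace Y then mdist Z (f (fst p)) (g (snd p)) else 0)" for p
  have u: "u (x, y) = mdist Z (f x) (g y)" if "x \<in> mspace X" "y \<in> mspace Y" for x y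
    using that by (simp add: u_def)
  show ?thesis
  proof (rule that)
    show "coupling X Y u"
      unfolding coupling_def
    proof (intro ballI)
      fix x x' y y' assume *: "x \<in> mspace X" "x' \<in> mspace X" "y \<in> mspace Y" "y' \<in> mspace Y"
      have "mdist Z (f x) (g y) \<le> mdist Z (f x) (f x') + mdist Z (f x') (g y)"
        "mdist Z (f x) (g y) \<le> mdist Z (f x) (g y') + mdist Z (g y') (g y)"
        "mdist Z (f x) (f x') \<le> mdist Z (f x) (g y) + mdist Z (g y) (f x')"
        "mdist Z (g y) (g y') \<le> mdist Z (g y) (f x) + mdist Z (f x) (g y')"
        using * fm gm by (auto intro!: mdist_triangle)
      then show "u (x, y) \<le> mdist X x x' + u (x', y) \<and> u (x, y) \<le> u (x, y') + mdist Y y' y \<and>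
        mdist X x x' \<le> u (x, y) + u (x', y) \<and> mdist Y y y' \<le> u (x, y) + u (x, y')"
        using * by (simp add: u fd gd mdist_commute)
    qed
    show "\<exists>y\<in>mspace Y. u (x, y) < h" if x: "x \<in> mspace X" for x
      using hausdorff_distance_less_imp(1)[OF hd _ _ C, of "f x"] x0 y0 x u by auto
    show "\<exists>x\<in>mspace X. u (x, y) < h" if y: "y \<in> mspace Y" for y
      using hausdorff_distance_less_imp(2)[OF hd _ _ C, of "g y"] x0 y0 y u by auto
  qed (auto simp: u_def)
qed

text \<open>Near-optimal couplings lie in a product of compact intervals, so a limit exists once the
  conditions are closed. The existential quantifier is the obstacle: over all of
  \<open>mspace Y\<close> it is an infinite union of closed sets. Restricted to a finite net it
  becomes a finite union, at the cost of a slightly larger bound.\<close>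

lemma optimal_coupling:
  assumes X: "compact_metric X" and Y: "compact_metric Y"
  obtains u where "coupling X Y u"
    "\<And>x \<epsilon>. x \<in> mspace X \<Longrightarrow> \<epsilon> > 0 \<Longrightarrow> \<exists>y\<in>mspace Y. u (x, y) \<le> gh_distance X Y + \<epsilon>"
    "\<And>y \<epsilon>. y \<in> mspace Y \<Longrightarrow> \<epsilon> > 0 \<Longrightarrow> \<exists>x\<in>mspace X. u (x, y) \<le> gh_distance X Y + \<epsilon>"
proof -
  let ?r = "gh_distance X Y"
  obtain A where A: "A > 0" "\<And>x y. x \<in> mspace X \<Longrightarrow> y \<in> mspace X \<Longrightarrow> mdist X x y \<le> A"
    using compact_metric_bounded[OF X] by metis
  define NX where "NX \<epsilon> = (SOME N. finite N \<and> N \<subseteq> mspace X \<and> (\<forall>x\<in>mspace X. \<exists>y\<in>N. mdist X x y < \<epsilon>))" for \<epsilon>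
  define NY where "NY \<epsilon> = (SOME N. finite N \<and> N \<subseteq> mspace Y \<and> (\<forall>x\<in>mspace Y. \<exists>y\<in>N. mdist Y x y < \<epsilon>))" for \<epsilon>
  have NX: "finite (NX \<epsilon>) \<and> NX \<epsilon> \<subseteq> mspace X \<and> (\<forall>x\<in>mspace X. \<exists>y\<in>NX \<epsilon>. mdist X x y < \<epsilon>)"
    if "\<epsilon> > 0" for \<epsilon>
    unfolding NX_def by (rule someI_ex) (metis compact_metric_net[OF X that])
  have NY: "finite (NY \<epsilon>) \<and> NY \<epsilon> \<subseteq> mspace Y \<and> (\<forall>x\<in>mspace Y. \<exists>y\<in>NY \<epsilon>. mdist Y x y < \<epsilon>)"
    if "\<epsilon> > 0" for \<epsilon>
    unfolding NY_def by (rule someI_ex) (metis compact_metric_net[OF Y that])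
  \<comment> \<open>The upper end comes from \<open>u (x, y) \<le> mdist X x x' + u (x', y)\<close>
    with \<open>x'\<close> almost optimal for \<open>y\<close>: at most \<open>A\<close> for the
    first term and \<open>?r + 1\<close> for the second.\<close>
  define K where "K = (PiE UNIV (\<lambda>_. {0..A + ?r + 1}) :: (real \<times> real \<Rightarrow> real) set)"
  have K: "compact K"
  proof -
    have "compactin (product_topology (\<lambda>_. euclidean) UNIV) K"
      unfolding K_def compactin_PiE by simp
    then show ?thesis by (simp add: euclidean_product_topology)
  qed
  \<comment> \<open>One \<open>\<epsilon>\<close> pays for near-optimality, the other for moving to
    the nearest point of the net.\<close>
  define F where "F \<epsilon> = {u. coupling X Y u \<and> (\<forall>x\<in>mspace X. \<exists>y\<in>NY \<epsilon>. u (x, y) \<le> ?r + 2 * \<epsilon>) \<and>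
      (\<forall>y\<in>mspace Y. \<exists>x\<in>NX \<epsilon>. u (x, y) \<le> ?r + 2 * \<epsilon>)}" for \<epsilon>
  have Fcl: "closed (F \<epsilon>)" if "\<epsilon> > 0" for \<epsilon>
  proof -
    have cl: "closed {u. u p \<le> ?r + 2 * \<epsilon>}" for p :: "real \<times> real"
      by (intro closed_Collect_le continuous_intros continuous_on_product_coordinates)
    have "F \<epsilon> = {u. coupling X Y u} \<inter> (\<Inter>x\<in>mspace X. \<Union>y\<in>NY \<epsilon>. {u. u (x, y) \<le> ?r + 2 * \<epsilon>}) \<inter>
      (\<Inter>y\<in>mspace Y. \<Union>x\<in>NX \<epsilon>. {u. u (x, y) \<le> ?r + 2 * \<epsilon>})"
      unfolding F_def by blast
    moreover have "closed \<dots>"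
      using NX[OF that] NY[OF that] by (intro closed_Int closed_INT ballI closed_UN cl closed_coupling) auto
    ultimately show ?thesis by simp
  qed
  have fip: "K \<inter> (\<Inter>\<epsilon>\<in>I. F \<epsilon>) \<noteq> {}" if I: "finite I" "I \<subseteq> {0<..}" for I
  proof -
    \<comment> \<open>One coupling serves all members of the finite family. Inserting
      \<open>1\<close> covers the empty family and yields \<open>\<delta> \<le> 1\<close>, which the
      upper end of \<open>K\<close> relies on.\<close>
    define \<delta> where "\<delta> = Min (insert 1 I)"
    have \<delta>: "\<delta> > 0" "\<delta> \<le> 1" "\<And>\<epsilon>. \<epsilon> \<in> I \<Longrightarrow> \<delta> \<le> \<epsilon>"
      using I by (auto simp: \<delta>_def)
    obtain u where u: "coupling X Y u"
      "\<And>x. x \<in> mspace X \<Longrightarrow> \<exists>y\<in>mspace Y. u (x, y) < ?r + \<delta>"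
      "\<And>y. y \<in> mspace Y \<Longrightarrow> \<exists>x\<in>mspace X. u (x, y) < ?r + \<delta>"
      "\<And>p. p \<in> mspace X \<times> mspace Y \<Longrightarrow> 0 \<le> u p"
      "\<And>p. p \<notin> mspace X \<times> mspace Y \<Longrightarrow> u p = 0"
      using near_optimal_coupling[OF X Y, of "?r + \<delta>"] \<delta>(1) by auto
    have r0: "0 \<le> ?r" using gh_distance_nonneg[OF X Y] .
    have "u (x, y) \<le> A + ?r + 1" if x: "x \<in> mspace X" and y: "y \<in> mspace Y" for x y
    proof -
      obtain x' where "x' \<in> mspace X" "u (x', y) < ?r + \<delta>" using u(3)[OF y] by blast
      then show ?thesis
        using couplingD(1)[OF u(1) x _ y y, of x'] A(2)[OF x, of x'] \<delta>(2) by linarith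
    qed
    then have "0 \<le> u p \<and> u p \<le> A + ?r + 1" for p
      using u(4,5)[of p] A(1) r0 by (cases "p \<in> mspace X \<times> mspace Y") auto
    then have "u \<in> K" by (simp add: K_def PiE_UNIV_domain)
    moreover have "u \<in> F \<epsilon>" if \<epsilon>: "\<epsilon> \<in> I" for \<epsilon>
    proof -
      have e: "\<epsilon> > 0" "\<delta> \<le> \<epsilon>" using \<epsilon> I \<delta> by auto
      have "\<exists>y'\<in>NY \<epsilon>. u (x, y') \<le> ?r + 2 * \<epsilon>" if x: "x \<in> mspace X" for x
      proof -
        obtain y where y: "y \<in> mspace Y" "u (x, y) < ?r + \<delta>" using u(2)[OF x] by blast
        then obtain y' where "y' \<in> NY \<epsilon>" "mdist Y y y' < \<epsilon>" "y' \<in> mspace Y"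
          using NY[OF e(1)] by blast
        then show ?thesis
          using couplingD(2)[OF u(1) x x, of y' y] y e by (intro bexI[of _ y']) auto
      qed
      moreover have "\<exists>x'\<in>NX \<epsilon>. u (x', y) \<le> ?r + 2 * \<epsilon>" if y: "y \<in> mspace Y" for y
      proof -
        obtain x where x: "x \<in> mspace X" "u (x, y) < ?r + \<delta>" using u(3)[OF y] by blast
        then obtain x' where "x' \<in> NX \<epsilon>" "mdist X x x' < \<epsilon>" "x' \<in> mspace X"
          using NX[OF e(1)] by blast
        then show ?thesis
          using couplingD(1)[OF u(1) _ _ y y, of x' x] x e mdist_commute[of X x x']
          by (intro bexI[of _ x']) auto
      qed
      ultimately show ?thesis using u(1) unfolding F_def by blast
    qed
    ultimately show ?thesis by blast
  qed
  have "K \<inter> (\<Inter>\<epsilon>\<in>{0<..}. F \<epsilon>) \<noteq> {}"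
    by (rule compact_imp_fip_image[OF K _ fip]) (simp_all add: Fcl)
  then obtain u where "u \<in> (\<Inter>\<epsilon>\<in>{0<..}. F \<epsilon>)" by blast
  then have u: "u \<in> F \<epsilon>" if "\<epsilon> > 0" for \<epsilon> using that by simp
  show ?thesis
  proof (rule that)
    show "coupling X Y u" using u[of 1] by (simp add: F_def)
    show "\<exists>y\<in>mspace Y. u (x, y) \<le> ?r + \<epsilon>" if "x \<in> mspace X" "\<epsilon> > 0" for x \<epsilon>
    proof -
      have "\<epsilon> / 2 > 0" using that by simp
      then have "u \<in> F (\<epsilon> / 2)" "NY (\<epsilon> / 2) \<subseteq> mspace Y" using u NY by blast+
      moreover from this obtain y where "y \<in> NY (\<epsilon> / 2)" "u (x, y) \<le> ?r + 2 * (\<epsilon> / 2)"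
        using \<open>x \<in> mspace X\<close> unfolding F_def by blast
      ultimately show ?thesis by (intro bexI[of _ y]) auto
    qed
    show "\<exists>x\<in>mspace X. u (x, y) \<le> ?r + \<epsilon>" if "y \<in> mspace Y" "\<epsilon> > 0" for y \<epsilon>
    proof -
      have "\<epsilon> / 2 > 0" using that by simp
      then have "u \<in> F (\<epsilon> / 2)" "NX (\<epsilon> / 2) \<subseteq> mspace X" using u NX by blast+
      moreover from this obtain x where "x \<in> NX (\<epsilon> / 2)" "u (x, y) \<le> ?r + 2 * (\<epsilon> / 2)"
        using \<open>y \<in> mspace Y\<close> unfolding F_def by blast
      ultimately show ?thesis by (intro bexI[of _ x]) auto
    qed
  qed
qed

text \<open>Closedness of \<open>R\<close> in the product, phrased by sequences and coordinate
  distances so that it combines directly with extracted subsequences.\<close>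

definition closed_relation :: "'a metric \<Rightarrow> 'b metric \<Rightarrow> ('a \<times> 'b) set \<Rightarrow> bool" where
  "closed_relation X Y R \<longleftrightarrow>
     (\<forall>\<sigma> x y. (\<forall>k::nat. \<sigma> k \<in> R) \<longrightarrow> x \<in> mspace X \<longrightarrow> y \<in> mspace Y \<longrightarrow>
        (\<lambda>k. mdist X (fst (\<sigma> k)) x) \<longlonglongrightarrow> 0 \<longrightarrow> (\<lambda>k. mdist Y (snd (\<sigma> k)) y) \<longlonglongrightarrow> 0 \<longrightarrow> (x, y) \<in> R)"

text \<open>The optimal correspondence is the sublevel set of an optimal coupling at its Hausdorff
  distance; it is total since the infima in the Hausdorff distance are attained.\<close>

lemma optimal_correspondence:
  assumes X: "compact_metric X" and Y: "compact_metric Y"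
  obtains R where "correspondence X Y (2 * gh_distance X Y) R" "closed_relation X Y R"
proof -
  let ?r = "gh_distance X Y"
  obtain u where u: "coupling X Y u"
    "\<And>x \<epsilon>. x \<in> mspace X \<Longrightarrow> \<epsilon> > 0 \<Longrightarrow> \<exists>y\<in>mspace Y. u (x, y) \<le> ?r + \<epsilon>"
    "\<And>y \<epsilon>. y \<in> mspace Y \<Longrightarrow> \<epsilon> > 0 \<Longrightarrow> \<exists>x\<in>mspace X. u (x, y) \<le> ?r + \<epsilon>"
    using optimal_coupling[OF X Y] by metis
  define R where "R = {(x, y). x \<in> mspace X \<and> y \<in> mspace Y \<and> u (x, y) \<le> ?r}"
  have inv: "(\<lambda>k. 1 / real (Suc k)) \<longlonglongrightarrow> 0"
    by (rule LIMSEQ_Suc[OF lim_1_over_n])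
  have left: "\<exists>y. (x, y) \<in> R" if x: "x \<in> mspace X" for x
  proof -
    have "\<forall>k. \<exists>y\<in>mspace Y. u (x, y) \<le> ?r + 1 / real (Suc k)" using u(2)[OF x] by simp
    then obtain \<sigma> where s: "\<And>k. \<sigma> k \<in> mspace Y" "\<And>k. u (x, \<sigma> k) \<le> ?r + 1 / real (Suc k)"
      by metis
    obtain y f where y: "y \<in> mspace Y" and f: "strict_mono (f :: nat \<Rightarrow> nat)"
      and lim: "(\<lambda>k. mdist Y (\<sigma> (f k)) y) \<longlonglongrightarrow> 0"
      using compact_metric_seq[OF Y s(1)] .
    have "(\<lambda>k. ?r + 1 / real (Suc (f k)) + mdist Y (\<sigma> (f k)) y) \<longlonglongrightarrow> ?r + 0 + 0"
      using LIMSEQ_subseq_LIMSEQ[OF inv f] lim by (intro tendsto_add tendsto_const) (simp_all add: comp_def)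
    moreover have "u (x, y) \<le> ?r + 1 / real (Suc (f k)) + mdist Y (\<sigma> (f k)) y" for k
      using couplingD(2)[OF u(1) x x y s(1), of "f k"] s(2)[of "f k"] by linarith
    ultimately have "u (x, y) \<le> ?r + 0 + 0"
      by (intro LIMSEQ_le_const) auto
    then show ?thesis using x y by (auto simp: R_def)
  qed
  have right: "\<exists>x. (x, y) \<in> R" if y: "y \<in> mspace Y" for y
  proof -
    have "\<forall>k. \<exists>x\<in>mspace X. u (x, y) \<le> ?r + 1 / real (Suc k)" using u(3)[OF y] by simp
    then obtain \<sigma> where s: "\<And>k. \<sigma> k \<in> mspace X" "\<And>k. u (\<sigma> k, y) \<le> ?r + 1 / real (Suc k)"
      by metis
    obtain x f where x: "x \<in> mspace X" and f: "strict_mono (f :: nat \<Rightarrow> nat)"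
      and lim: "(\<lambda>k. mdist X (\<sigma> (f k)) x) \<longlonglongrightarrow> 0"
      using compact_metric_seq[OF X s(1)] .
    have "(\<lambda>k. ?r + 1 / real (Suc (f k)) + mdist X (\<sigma> (f k)) x) \<longlonglongrightarrow> ?r + 0 + 0"
      using LIMSEQ_subseq_LIMSEQ[OF inv f] lim by (intro tendsto_add tendsto_const) (simp_all add: comp_def)
    moreover have "u (x, y) \<le> ?r + 1 / real (Suc (f k)) + mdist X (\<sigma> (f k)) x" for k
      using couplingD(1)[OF u(1) x s(1) y y, of "f k"] s(2)[of "f k"] mdist_commute[of X x] by simp
    ultimately have "u (x, y) \<le> ?r + 0 + 0"
      by (intro LIMSEQ_le_const) auto
    then show ?thesis using x y by (auto simp: R_def)
  qed
  show ?thesis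
  proof (rule that)
    have "\<bar>mdist X x x' - mdist Y y y'\<bar> \<le> 2 * ?r" if "(x, y) \<in> R" "(x', y') \<in> R" for x y x' y'
    proof -
      have *: "x \<in> mspace X" "x' \<in> mspace X" "y \<in> mspace Y" "y' \<in> mspace Y"
        "u (x, y) \<le> ?r" "u (x', y') \<le> ?r"
        using that by (auto simp: R_def)
      \<comment> \<open>Going from \<open>x\<close> to \<open>x'\<close> by way of \<open>y\<close>
        and \<open>y'\<close> crosses between the spaces twice, each time at cost at most
        \<open>?r\<close>; exchanging the roles of \<open>X\<close> and \<open>Y\<close> gives the
        other sign.\<close>
      have "mdist X x x' \<le> u (x, y') + u (x', y')" "u (x, y') \<le> u (x, y) + mdist Y y y'"
        "mdist Y y' y \<le> u (x', y') + u (x', y)" "u (x', y) \<le> mdist X x' x + u (x, y)"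
        using couplingD[OF u(1)] * by auto
      then show ?thesis
        using * mdist_commute[of X x x'] mdist_commute[of Y y y'] by linarith
    qed
    then have "\<forall>(x, y)\<in>R. \<forall>(x', y')\<in>R. \<bar>mdist X x x' - mdist Y y y'\<bar> \<le> 2 * ?r"
      by blast
    moreover have "R \<subseteq> mspace X \<times> mspace Y" by (auto simp: R_def)
    moreover have "mspace X \<subseteq> fst ` R" using left by force
    moreover have "mspace Y \<subseteq> snd ` R" using right by force
    ultimately show "correspondence X Y (2 * ?r) R"
      unfolding correspondence_def by auto
    show "closed_relation X Y R"
      unfolding closed_relation_def
    proof (intro allI impI)
      fix \<sigma> :: "nat \<Rightarrow> real \<times> real" and x y
      assume s: "\<forall>k. \<sigma> k \<in> R" and x: "x \<in> mspace X" and y: "y \<in> mspace Y"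
        and lim: "(\<lambda>k. mdist X (fst (\<sigma> k)) x) \<longlonglongrightarrow> 0" "(\<lambda>k. mdist Y (snd (\<sigma> k)) y) \<longlonglongrightarrow> 0"
      have "(\<lambda>k. mdist X (fst (\<sigma> k)) x + ?r + mdist Y (snd (\<sigma> k)) y) \<longlonglongrightarrow> 0 + ?r + 0"
        using lim by (intro tendsto_add tendsto_const)
      moreover have "u (x, y) \<le> mdist X (fst (\<sigma> k)) x + ?r + mdist Y (snd (\<sigma> k)) y" for k
      proof -
        have *: "fst (\<sigma> k) \<in> mspace X" "snd (\<sigma> k) \<in> mspace Y" "u (fst (\<sigma> k), snd (\<sigma> k)) \<le> ?r"
          using spec[OF s, of k] by (cases "\<sigma> k"; simp add: R_def)+
        show ?thesis
          using couplingD(1)[OF u(1) x *(1) y y] couplingD(2)[OF u(1) *(1,1) y *(2)] *(3)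
            mdist_commute[of X x] by simp
      qed
      ultimately have "u (x, y) \<le> 0 + ?r + 0"
        by (intro LIMSEQ_le_const) auto
      then show "(x, y) \<in> R" using x y by (simp add: R_def)
    qed
  qed
qed

section \<open>Operations on correspondences and the metric axioms for \<open>d_GH\<close>\<close>

lemma correspondence_sym:
  assumes "correspondence X Y c R"
  shows "correspondence Y X c (R\<inverse>)"
proof -
  have "\<bar>mdist Y y y' - mdist X x x'\<bar> \<le> c" if "(x, y) \<in> R" "(x', y') \<in> R" for x y x' y'
    using correspondence_distortion[OF assms that] by (simp add: abs_minus_commute)
  moreover have "fst ` (R\<inverse>) = snd ` R" "snd ` (R\<inverse>) = fst ` R" by force+
  ultimately show ?thesis
    using assms unfolding correspondence_def by auto
qed

lemma correspondence_comp:
  assumes R: "correspondence X Y c R" and S: "correspondence Y Z c' S"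
  shows "correspondence X Z (c + c') (R O S)"
proof -
  have "\<bar>mdist X x x' - mdist Z z z'\<bar> \<le> c + c'"
    if "(x, y) \<in> R" "(y, z) \<in> S" "(x', y') \<in> R" "(y', z') \<in> S" for x y z x' y' z'
    using correspondence_distortion[OF R that(1,3)] correspondence_distortion[OF S that(2,4)]
    by linarith
  then have "\<forall>(x, z)\<in>R O S. \<forall>(x', z')\<in>R O S. \<bar>mdist X x x' - mdist Z z z'\<bar> \<le> c + c'"
    by auto
  moreover have "R O S \<subseteq> mspace X \<times> mspace Z"
    using R S unfolding correspondence_def by blast
  moreover have "mspace X \<subseteq> fst ` (R O S)"
  proof
    fix x assume "x \<in> mspace X"
    with R obtain y where "(x, y) \<in> R" "y \<in> mspace Y" by (rule correspondence_left)
    moreover from S this(2) obtain z where "(y, z) \<in> S" by (rule correspondence_left)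
    ultimately show "x \<in> fst ` (R O S)" by force
  qed
  moreover have "mspace Z \<subseteq> snd ` (R O S)"
  proof
    fix z assume "z \<in> mspace Z"
    with S obtain y where "(y, z) \<in> S" "y \<in> mspace Y" by (rule correspondence_right)
    moreover from R this(2) obtain x where "(x, y) \<in> R" by (rule correspondence_right)
    ultimately show "z \<in> snd ` (R O S)" by force
  qed
  ultimately show ?thesis
    unfolding correspondence_def by (auto 0 3)
qed

text \<open>Any selection \<open>f\<close> from \<open>R\<close> is an isometry. It is onto because
  \<open>y\<close> and \<open>f x\<close>, both related to the same \<open>x\<close>, must be at
  distance 0.\<close>

lemma correspondence_zero_imp_isometric:
  assumes "correspondence X Y 0 R"
  shows "isometric X Y"
proof -
  have "\<forall>x\<in>mspace X. \<exists>y. (x, y) \<in> R" by (meson assms correspondence_left)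
  then obtain f where f: "\<And>x. x \<in> mspace X \<Longrightarrow> (x, f x) \<in> R" by metis
  have RR: "R \<subseteq> mspace X \<times> mspace Y" using assms unfolding correspondence_def by blast
  have eq: "mdist X x x' = mdist Y y y'" if "(x, y) \<in> R" "(x', y') \<in> R" for x y x' y'
    using correspondence_distortion[OF assms that] by simp
  have "y \<in> f ` mspace X" if y: "y \<in> mspace Y" for y
  proof -
    obtain x where x: "(x, y) \<in> R" "x \<in> mspace X" using correspondence_right[OF assms y] .
    have "mdist Y y (f x) = mdist X x x" using eq[OF x(1) f[OF x(2)]] by simp
    also have "\<dots> = 0" using x by simp
    finally have "y = f x" using RR f[OF x(2)] y by (auto simp: mdist_zero)
    then show ?thesis using x by blast
  qed
  moreover have "f x \<in> mspace Y" if "x \<in> mspace X" for x using f[OF that] RR by blast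
  moreover have "isometric_embedding X Y f"
    unfolding isometric_embedding_def using f RR eq by (metis calculation(2) image_subsetI)
  ultimately show ?thesis unfolding isometric_def by blast
qed

lemma isometric_imp_correspondence_zero:
  assumes "isometric X Y"
  obtains R where "correspondence X Y 0 R"
proof -
  obtain f where f: "isometric_embedding X Y f" "f ` mspace X = mspace Y"
    using assms unfolding isometric_def by blast
  then have "correspondence X Y 0 ((\<lambda>x. (x, f x)) ` mspace X)"
    unfolding correspondence_def isometric_embedding_def by (auto simp: image_image)
  then show ?thesis using that by blast
qed

text \<open>Symmetry and the triangle inequality come from inverting and composing optimal
  correspondences. Definiteness depends on the optimum being attained: distance 0 provides a
  correspondence of distortion exactly 0.\<close>

lemma Metric_space_gh: "Metric_space UNIV d_GH"
proof
  fix P Q T :: gh_space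
  obtain X where X: "compact_metric X" "P = gh_class X" by (rule gh_class_cases)
  obtain Y where Y: "compact_metric Y" "Q = gh_class Y" by (rule gh_class_cases)
  obtain Z where Z: "compact_metric Z" "T = gh_class Z" by (rule gh_class_cases)
  have le: "gh_distance Y X \<le> gh_distance X Y"
    if XY: "compact_metric X" "compact_metric Y" for X Y
  proof -
    obtain R where "correspondence X Y (2 * gh_distance X Y) R"
      using optimal_correspondence[OF XY] .
    then show ?thesis
      using gh_distance_le_correspondence[OF XY(2,1)] correspondence_sym by blast
  qed
  show "0 \<le> d_GH P Q"
    using X Y by (simp add: d_GH_gh_class gh_distance_nonneg)
  show "d_GH P Q = d_GH Q P"
    using X Y le by (simp add: d_GH_gh_class order_antisym)
  show "(d_GH P Q = 0) = (P = Q)"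
  proof
    assume "d_GH P Q = 0"
    then have "gh_distance X Y = 0" using X Y by (simp add: d_GH_gh_class)
    then obtain R where "correspondence X Y 0 R"
      using optimal_correspondence[OF X(1) Y(1)] by (metis mult_zero_right)
    then show "P = Q"
      using X Y by (simp add: gh_class_eq_iff correspondence_zero_imp_isometric)
  next
    assume "P = Q"
    then have "isometric X Y" using X Y by (simp add: gh_class_eq_iff)
    then obtain R where "correspondence X Y (2 * 0) R"
      using isometric_imp_correspondence_zero by auto
    then have "gh_distance X Y \<le> 0" using gh_distance_le_correspondence X Y by blast
    then show "d_GH P Q = 0"
      using X Y gh_distance_nonneg[of X Y] by (simp add: d_GH_gh_class)
  qed
  show "d_GH P T \<le> d_GH P Q + d_GH Q T"
  proof -
    obtain R where R: "correspondence X Y (2 * gh_distance X Y) R"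
      using optimal_correspondence[OF X(1) Y(1)] .
    obtain S where S: "correspondence Y Z (2 * gh_distance Y Z) S"
      using optimal_correspondence[OF Y(1) Z(1)] .
    have "correspondence X Z (2 * (gh_distance X Y + gh_distance Y Z)) (R O S)"
      using correspondence_comp[OF R S] by (simp add: distrib_left)
    then show ?thesis
      using gh_distance_le_correspondence X Y Z by (simp add: d_GH_gh_class)
  qed
qed


section \<open>Brouwer's characterisation of the Cantor set\<close>

definition clopenin :: "'a topology \<Rightarrow> 'a set \<Rightarrow> bool" where
  "clopenin T U \<longleftrightarrow> openin T U \<and> closedin T U"

lemma clopenin_Int: "clopenin T U \<Longrightarrow> clopenin T V \<Longrightarrow> clopenin T (U \<inter> V)"
  and clopenin_Diff: "clopenin T U \<Longrightarrow> clopenin T V \<Longrightarrow> clopenin T (U - V)"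
  by (auto simp: clopenin_def)

lemma clopenin_topspace: "clopenin T (topspace T)"
  by (simp add: clopenin_def)

lemma clopenin_vimage:
  "continuous_map S T f \<Longrightarrow> clopenin T U \<Longrightarrow> clopenin S {x \<in> topspace S. f x \<in> U}"
  by (simp add: clopenin_def openin_continuous_map_preimage closedin_continuous_map_preimage)

lemma clopenin_bool_coordinate: "clopenin euclidean {a :: nat \<Rightarrow> bool. a n}"
proof -
  have "{a :: nat \<Rightarrow> bool. a n} = (\<lambda>a. a n) -` {True}" by auto
  moreover have "clopenin euclidean ((\<lambda>a :: nat \<Rightarrow> bool. a n) -` {True})"
    using continuous_on_product_coordinates[of n]
    by (simp add: clopenin_def open_vimage closed_vimage open_discrete
        continuous_on_product_coordinates flip: open_openin closed_closedin)
  ultimately show ?thesis by simp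
qed

text \<open>Takes the place of a base of clopen sets: in a compact space it suffices for coding the
  points by Boolean sequences, and it is easily pulled back along coordinate maps.\<close>

definition separates_points :: "'a topology \<Rightarrow> 'a set set \<Rightarrow> bool" where
  "separates_points T \<B> \<longleftrightarrow>
     (\<forall>x\<in>topspace T. \<forall>y\<in>topspace T. x \<noteq> y \<longrightarrow> (\<exists>B\<in>\<B>. \<not> (x \<in> B \<longleftrightarrow> y \<in> B)))"

text \<open>Cells are split recursively into two nonempty clopen halves; at stage \<open>n\<close> the \<open>n\<close>-th clopen
  set \<open>B n\<close> is used if it splits the cell, so that every branch shrinks to a single point.\<close>

theorem homeomorphic_space_Cantor:
  fixes T :: "'a topology"
  assumes comp: "compact_space T" and ne: "topspace T \<noteq> {}"
    and perfect: "\<And>x. x \<in> topspace T \<Longrightarrow> \<not> openin T {x}"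
    and \<B>: "countable \<B>" "\<And>B. B \<in> \<B> \<Longrightarrow> clopenin T B" "separates_points T \<B>"
  shows "T homeomorphic_space (euclidean :: (nat \<Rightarrow> bool) topology)"
proof -
  \<comment> \<open>A cell is open, so it cannot be a single point; a member of \<open>\<B>\<close>
    that separates two of its points cuts off a proper clopen part.\<close>
  have proper: "\<exists>A. clopenin T A \<and> A \<noteq> {} \<and> A \<subset> K"
    if K: "clopenin T K" "K \<noteq> {}" for K
  proof -
    obtain x where x: "x \<in> K" using K by blast
    have sub: "K \<subseteq> topspace T" using K by (simp add: clopenin_def openin_subset)
    have "K \<noteq> {x}" using perfect x sub K by (auto simp: clopenin_def)
    then obtain y where y: "y \<in> K" "y \<noteq> x" using x by blast
    then obtain B where "B \<in> \<B>" "\<not> (x \<in> B \<longleftrightarrow> y \<in> B)"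
      using \<B>(3) x sub unfolding separates_points_def by blast
    then show ?thesis
      using x y K \<B>(2) by (intro exI[of _ "K \<inter> B"]) (auto intro: clopenin_Int)
  qed
  \<comment> \<open>Two distinct points are needed to see that \<open>\<B>\<close> is nonempty,
    without which \<open>from_nat_into\<close> does not enumerate it.\<close>
  obtain x0 where x0: "x0 \<in> topspace T" using ne by blast
  then obtain y0 where "y0 \<in> topspace T" "y0 \<noteq> x0"
    using perfect openin_topspace[of T] by (metis is_singletonI' is_singleton_def empty_iff singletonD)
  then have "\<B> \<noteq> {}" using \<B>(3) x0 unfolding separates_points_def by blast
  define B where "B = from_nat_into \<B>"
  have B: "clopenin T (B n)" for n
    unfolding B_def using \<B>(2) from_nat_into[OF \<open>\<B> \<noteq> {}\<close>] by blast
  have Bsep: "\<exists>n. \<not> (x \<in> B n \<longleftrightarrow> y \<in> B n)"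
    if xy: "x \<in> topspace T" "y \<in> topspace T" "x \<noteq> y" for x y
  proof -
    obtain U where "U \<in> \<B>" "\<not> (x \<in> U \<longleftrightarrow> y \<in> U)"
      using \<B>(3) xy unfolding separates_points_def by blast
    then show ?thesis
      unfolding B_def using from_nat_into_surj[OF \<B>(1)] by metis
  qed
  define split where "split n K = (if K \<inter> B n \<noteq> {} \<and> K - B n \<noteq> {} then K \<inter> B n
      else (SOME A. clopenin T A \<and> A \<noteq> {} \<and> A \<subset> K))" for n K
  have split: "clopenin T (split n K) \<and> split n K \<noteq> {} \<and> split n K \<subset> K"
    if K: "clopenin T K" "K \<noteq> {}" for n K
  proof (cases "K \<inter> B n \<noteq> {} \<and> K - B n \<noteq> {}")
    case True
    then show ?thesis unfolding split_def using K B by (auto intro: clopenin_Int)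
  next
    case False
    then have "split n K = (SOME A. clopenin T A \<and> A \<noteq> {} \<and> A \<subset> K)" unfolding split_def by auto
    then show ?thesis using someI_ex[OF proper[OF K]] by simp
  qed
  define cell where "cell a = rec_nat (topspace T)
      (\<lambda>n K. if a n then split n K else K - split n K)" for a :: "nat \<Rightarrow> bool"
  have cell_0: "cell a 0 = topspace T"
    and cell_Suc: "cell a (Suc n) = (if a n then split n (cell a n) else cell a n - split n (cell a n))"
    for a n
    by (simp_all add: cell_def)
  have cell: "clopenin T (cell a n) \<and> cell a n \<noteq> {}" for a n
  proof (induction n)
    case 0
    then show ?case using ne by (simp add: cell_0 clopenin_topspace)
  next
    case (Suc n)
    then show ?case
      using split[of "cell a n" n] by (auto simp: cell_Suc clopenin_Diff)
  qed
  have dec: "cell a (Suc n) \<subseteq> cell a n" for a n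
    using split[of "cell a n" n] cell[of a n] by (auto simp: cell_Suc)
  have cell_cong: "cell a n = cell b n" if "\<And>k. k < n \<Longrightarrow> a k = b k" for a b n
    using that by (induction n) (simp_all add: cell_0 cell_Suc)
  \<comment> \<open>\<open>cell\<close> needs a branch in advance, while the branch of
    \<open>x\<close> depends on the cells containing \<open>x\<close>. Following the cell of
    \<open>x\<close> directly breaks this circle; \<open>loc\<close> is afterwards recognised as
    \<open>cell (\<phi> x)\<close>.\<close>
  define loc where "loc x = rec_nat (topspace T)
      (\<lambda>n K. if x \<in> split n K then split n K else K - split n K)" for x
  define \<phi> where "\<phi> x n \<longleftrightarrow> x \<in> split n (loc x n)" for x n
  have loc: "loc x n = cell (\<phi> x) n" for x n
    by (induction n) (simp_all add: loc_def cell_0 cell_Suc \<phi>_def)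
  have \<phi>: "\<phi> x n \<longleftrightarrow> x \<in> split n (cell (\<phi> x) n)" for x n
    using \<phi>_def loc by simp
  have in_cell: "x \<in> cell (\<phi> x) n" if "x \<in> topspace T" for x n
  proof (induction n)
    case 0
    then show ?case using that by (simp add: cell_0)
  next
    case (Suc n)
    then show ?case using \<phi>[of x n] by (simp add: cell_Suc)
  qed
  \<comment> \<open>The two halves of a cell are disjoint, so a cell determines the code of its
    points up to its depth. This yields both the continuity of \<open>\<phi>\<close>, whose
    coordinates are locally constant, and its surjectivity.\<close>
  have code: "\<phi> x k = a k" if "x \<in> cell a n" "k < n" for x a n k
    using that
  proof (induction n arbitrary: k)
    case (Suc n)
    have x: "x \<in> cell a n" using Suc.prems dec by blast
    have "cell (\<phi> x) n = cell a n" using Suc.IH[OF x] by (intro cell_cong) auto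
    then have "\<phi> x n = a n" using Suc.prems \<phi>[of x n] by (auto simp: cell_Suc split: if_splits)
    then show ?case using Suc.IH[OF x] Suc.prems by (cases "k = n") auto
  qed simp
  have "continuous_map T euclidean (\<lambda>x. \<phi> x n)" for n
  proof -
    have "openin T {x \<in> topspace T. \<phi> x n \<in> U}" for U
    proof (subst openin_subopen, intro ballI)
      fix x assume x: "x \<in> {x \<in> topspace T. \<phi> x n \<in> U}"
      have "openin T (cell (\<phi> x) (Suc n))" using cell by (simp add: clopenin_def)
      moreover have "x \<in> cell (\<phi> x) (Suc n)" using x in_cell by blast
      moreover have "cell (\<phi> x) (Suc n) \<subseteq> {x \<in> topspace T. \<phi> x n \<in> U}"
        using code[of _ "\<phi> x" "Suc n" n] x openin_subset[OF calculation(1)] by auto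
      ultimately show "\<exists>V. openin T V \<and> x \<in> V \<and> V \<subseteq> {x \<in> topspace T. \<phi> x n \<in> U}" by blast
    qed
    then show ?thesis by (simp add: continuous_map_def)
  qed
  then have "continuous_map T (product_topology (\<lambda>_. euclidean) UNIV) \<phi>"
    by (intro continuous_map_coordinatewise_then_product) auto
  then have cont: "continuous_map T euclidean \<phi>"
    by (simp add: euclidean_product_topology)
  have inj: "inj_on \<phi> (topspace T)"
  proof (rule inj_onI, rule ccontr)
    fix x y assume xy: "x \<in> topspace T" "y \<in> topspace T" "\<phi> x = \<phi> y" "x \<noteq> y"
    \<comment> \<open>Points with equal codes share every cell. At stage \<open>n\<close> that cell
      meets both \<open>B n\<close> and its complement, so it is split by \<open>B n\<close> itself,
      which sends the points to different halves.\<close>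
    obtain n where n: "\<not> (x \<in> B n \<longleftrightarrow> y \<in> B n)" using Bsep xy by blast
    let ?K = "cell (\<phi> x) n"
    have K: "x \<in> ?K" "y \<in> ?K" using in_cell[of x n] in_cell[of y n] xy by auto
    then have "split n ?K = ?K \<inter> B n" using n unfolding split_def by auto
    then show False using n K \<phi>[of x n] \<phi>[of y n] xy(3) by auto
  qed
  have surj: "\<phi> ` topspace T = topspace euclidean"
  proof -
    have "a \<in> \<phi> ` topspace T" for a
    proof -
      have "(\<Inter>n. cell a n) \<noteq> {}"
      proof (rule compact_space_imp_nest[OF comp])
        show "decseq (cell a)" using dec by (rule decseq_SucI)
      qed (use cell in \<open>auto simp: clopenin_def\<close>)
      then obtain x where x: "\<And>n. x \<in> cell a n" by blast
      have "\<phi> x = a" using code x by blast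
      moreover have "x \<in> topspace T" using x[of 0] by (simp add: cell_0)
      ultimately show ?thesis by blast
    qed
    then show ?thesis by auto
  qed
  have "Hausdorff_space (euclidean :: bool topology)"
    unfolding Hausdorff_space_def
  proof (intro allI impI)
    fix x y :: bool assume "x \<in> topspace euclidean \<and> y \<in> topspace euclidean \<and> x \<noteq> y"
    then show "\<exists>U V. openin euclidean U \<and> openin euclidean V \<and> x \<in> U \<and> y \<in> V \<and> disjnt U V"
      by (intro exI[of _ "{x}"] exI[of _ "{y}"]) (simp add: open_discrete flip: open_openin)
  qed
  then have "Hausdorff_space (product_topology (\<lambda>_. euclidean :: bool topology) (UNIV :: nat set))"
    unfolding Hausdorff_space_product_topology by simp
  then have "Hausdorff_space (euclidean :: (nat \<Rightarrow> bool) topology)"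
    by (simp add: euclidean_product_topology)
  then show ?thesis
    using continuous_imp_homeomorphic_map[OF cont comp _ surj inj] homeomorphic_map_imp_homeomorphic_space
    by blast
qed

section \<open>The middle-thirds Cantor set as the space of Boolean sequences\<close>

definition cantor_expansion :: "(nat \<Rightarrow> bool) \<Rightarrow> real" where
  "cantor_expansion a = (\<Sum>n. (if a n then 2 else 0) / 3 ^ Suc n)"

lemma summable_cantor: "summable (\<lambda>n. (if a n then 2 else 0) / 3 ^ Suc n :: real)"
  and summable_cantor_bound: "summable (\<lambda>n. 2 / 3 ^ Suc n :: real)"
  and cantor_bound_sums: "(\<lambda>n. 2 / 3 ^ Suc n :: real) sums 1"
proof -
  have "(\<lambda>n. (2/3) * (1 / 3) ^ n :: real) sums ((2/3) * (1 / (1 - 1/3)))"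
    by (intro sums_mult geometric_sums) simp
  then show *: "(\<lambda>n. 2 / 3 ^ Suc n :: real) sums 1"
    by (simp add: power_divide field_simps)
  then show s: "summable (\<lambda>n. 2 / 3 ^ Suc n :: real)" by (rule sums_summable)
  show "summable (\<lambda>n. (if a n then 2 else 0) / 3 ^ Suc n :: real)"
    by (rule summable_comparison_test[OF _ s]) auto
qed

lemma cantor_expansion_bounds: "0 \<le> cantor_expansion a" "cantor_expansion a \<le> 1"
proof -
  show "0 \<le> cantor_expansion a"
    unfolding cantor_expansion_def by (rule suminf_nonneg[OF summable_cantor]) auto
  have "cantor_expansion a \<le> (\<Sum>n. 2 / 3 ^ Suc n)"
    unfolding cantor_expansion_def by (rule suminf_le[OF _ summable_cantor summable_cantor_bound]) auto
  then show "cantor_expansion a \<le> 1" using cantor_bound_sums by (simp add: sums_iff)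
qed

lemma cantor_expansion_shift:
  "cantor_expansion a = (if a 0 then 2 / 3 else 0) + cantor_expansion (\<lambda>n. a (Suc n)) / 3"
proof -
  have "cantor_expansion a = (\<Sum>n. (if a (Suc n) then 2 else 0) / 3 ^ Suc (Suc n)) + (if a 0 then 2 else 0) / 3 ^ Suc 0"
    unfolding cantor_expansion_def using suminf_split_head[OF summable_cantor[of a]] by simp
  also have "(\<Sum>n. (if a (Suc n) then 2 else 0) / 3 ^ Suc (Suc n) :: real)
      = (\<Sum>n. (if a (Suc n) then 2 else 0) / 3 ^ Suc n / 3)"
    by (simp add: field_simps)
  also have "\<dots> = cantor_expansion (\<lambda>n. a (Suc n)) / 3"
    unfolding cantor_expansion_def by (rule suminf_divide[OF summable_cantor])
  finally show ?thesis by simp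
qed

text \<open>A first digit 0 gives a value of at most 1/3 and a first digit 2 one of at least 2/3, so
  the value determines the first digit; the shift identity passes to the later digits.\<close>

lemma inj_cantor_expansion: "inj cantor_expansion"
proof (rule injI, rule ext)
  fix a b :: "nat \<Rightarrow> bool" and n
  assume "cantor_expansion a = cantor_expansion b"
  then show "a n = b n"
  proof (induction n arbitrary: a b)
    case 0
    then show ?case
      using cantor_expansion_shift[of a] cantor_expansion_shift[of b]
        cantor_expansion_bounds[of "\<lambda>n. a (Suc n)"] cantor_expansion_bounds[of "\<lambda>n. b (Suc n)"]
      by (auto split: if_splits)
  next
    case (Suc n)
    have "a 0 = b 0"
      using Suc.prems cantor_expansion_shift[of a] cantor_expansion_shift[of b]
        cantor_expansion_bounds[of "\<lambda>n. a (Suc n)"] cantor_expansion_bounds[of "\<lambda>n. b (Suc n)"]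
      by (auto split: if_splits)
    then have "cantor_expansion (\<lambda>n. a (Suc n)) = cantor_expansion (\<lambda>n. b (Suc n))"
      using Suc.prems cantor_expansion_shift[of a] cantor_expansion_shift[of b] by simp
    then show ?case by (rule Suc.IH)
  qed
qed

text \<open>The partial sums depend on finitely many coordinates and converge uniformly by the
  geometric bound.\<close>

lemma continuous_cantor_expansion: "continuous_on UNIV cantor_expansion"
proof -
  have "uniform_limit UNIV (\<lambda>n a. \<Sum>i<n. (if a i then 2 else 0) / 3 ^ Suc i :: real)
      (\<lambda>a. \<Sum>i. (if a i then 2 else 0) / 3 ^ Suc i) sequentially"
    by (rule Weierstrass_m_test[OF _ summable_cantor_bound]) auto
  moreover have "continuous_on UNIV (\<lambda>a. \<Sum>i<n. (if a i then 2 else 0) / 3 ^ Suc i :: real)" for n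
  proof -
    have "continuous_on UNIV ((\<lambda>b. if b then 2 else 0 :: real) \<circ> (\<lambda>a :: nat \<Rightarrow> bool. a i))" for i
      by (rule continuous_on_compose) auto
    then show ?thesis
      by (intro continuous_intros) (auto simp: comp_def)
  qed
  ultimately show ?thesis
    unfolding cantor_expansion_def[abs_def]
    by (intro uniform_limit_theorem[where F = sequentially]) auto
qed

lemma cantor_set_homeomorphic:
  "top_of_set cantor_set homeomorphic_space (euclidean :: (nat \<Rightarrow> bool) topology)"
proof -
  have "compact_space (euclidean :: bool topology)"
    unfolding compact_space_def by (simp add: finite_imp_compact)
  then have "compact_space (product_topology (\<lambda>_. euclidean :: bool topology) (UNIV :: nat set))"
    by (simp add: compact_space_product_topology)
  then have c: "compact_space (euclidean :: (nat \<Rightarrow> bool) topology)"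
    by (simp add: euclidean_product_topology)
  have r: "cantor_set = range cantor_expansion"
    unfolding cantor_set_def cantor_expansion_def ..
  have "continuous_map euclidean (top_of_set cantor_set) cantor_expansion"
    using continuous_cantor_expansion r by (auto simp: continuous_map_in_subtopology)
  then have "homeomorphic_map euclidean (top_of_set cantor_set) cantor_expansion"
    using c r inj_cantor_expansion
    by (intro continuous_imp_homeomorphic_map) (auto intro: Hausdorff_space_subtopology)
  then show ?thesis
    by (meson homeomorphic_map_imp_homeomorphic_space homeomorphic_space_sym)
qed

text \<open>A basic open set constrains only finitely many coordinates; flipping an unconstrained
  one yields a second point.\<close>

lemma bool_sequences_perfect: "\<not> openin euclidean {a :: nat \<Rightarrow> bool}"
proof
  assume "openin euclidean {a}"
  then have "openin (product_topology (\<lambda>_::nat. euclidean :: bool topology) UNIV) {a}"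
    by (simp add: euclidean_product_topology)
  then obtain U where U: "finite {i \<in> UNIV. U i \<noteq> topspace (euclidean :: bool topology)}"
    "a \<in> PiE UNIV U" "PiE UNIV U \<subseteq> {a}"
    unfolding openin_product_topology_alt by blast
  then obtain i where "U i = UNIV" using ex_new_if_finite[OF infinite_UNIV_nat U(1)] by auto
  then have "a(i := \<not> a i) \<in> PiE UNIV U" using U(2) by (auto simp: PiE_iff)
  then have "a(i := \<not> a i) = a" using U(3) by blast
  then show False by (metis fun_upd_same)
qed

lemma homeomorphic_cantor_set_imp:
  assumes "T homeomorphic_space top_of_set cantor_set"
  obtains \<B> where "countable \<B>" "\<And>B. B \<in> \<B> \<Longrightarrow> clopenin T B" "separates_points T \<B>"
    and "\<And>x. x \<in> topspace T \<Longrightarrow> \<not> openin T {x}"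
proof -
  have "T homeomorphic_space (euclidean :: (nat \<Rightarrow> bool) topology)"
    using assms cantor_set_homeomorphic homeomorphic_space_trans by blast
  then obtain f where f: "homeomorphic_map T (euclidean :: (nat \<Rightarrow> bool) topology) f"
    unfolding homeomorphic_space by blast
  define \<B> where "\<B> = range (\<lambda>n. {x \<in> topspace T. f x \<in> {a. a n}})"
  show ?thesis
  proof (rule that)
    show "countable \<B>" by (simp add: \<B>_def)
    show "clopenin T B" if "B \<in> \<B>" for B
      using that clopenin_vimage[OF homeomorphic_imp_continuous_map[OF f] clopenin_bool_coordinate]
      unfolding \<B>_def by blast
    show "separates_points T \<B>"
      unfolding separates_points_def
    proof (intro ballI impI)
      fix x y assume xy: "x \<in> topspace T" "y \<in> topspace T" "x \<noteq> y"
      then have "f x \<noteq> f y" using homeomorphic_imp_injective_map[OF f] by (auto dest: inj_onD)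
      then obtain n where "f x n \<noteq> f y n" by blast
      then show "\<exists>B\<in>\<B>. \<not> (x \<in> B \<longleftrightarrow> y \<in> B)" using xy unfolding \<B>_def by auto
    qed
    show "\<not> openin T {x}" if "x \<in> topspace T" for x
      using homeomorphic_map_openness[OF f, of "{x}"] bool_sequences_perfect[of "f x"] that by simp
  qed
qed


section \<open>Geodesics with a truncated factor\<close>

text \<open>Pseudometrics are needed because at each end of the path the distance ignores all but
  one coordinate. Nonnegativity and symmetry are demanded on the whole type, in the form in which
  \<open>Metric_space\<close> asks for them.\<close>

definition compact_pseudometric :: "'p set \<Rightarrow> ('p \<Rightarrow> 'p \<Rightarrow> real) \<Rightarrow> bool" where
  "compact_pseudometric P d \<longleftrightarrow> P \<noteq> {} \<and>
     (\<forall>a b. 0 \<le> d a b \<and> d a b = d b a) \<and> (\<forall>a\<in>P. d a a = 0) \<and>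
     (\<forall>a\<in>P. \<forall>b\<in>P. \<forall>c\<in>P. d a c \<le> d a b + d b c) \<and>
     (\<forall>\<sigma> :: nat \<Rightarrow> 'p. (\<forall>k. \<sigma> k \<in> P) \<longrightarrow>
        (\<exists>l\<in>P. \<exists>r. strict_mono r \<and> (\<lambda>k. d (\<sigma> (r k)) l) \<longlonglongrightarrow> 0))"

lemma compact_pseudometricD:
  assumes "compact_pseudometric P d"
  shows "P \<noteq> {}" and "0 \<le> d a b" and "a \<in> P \<Longrightarrow> d a a = 0"
    and "d a b = d b a"
    and "a \<in> P \<Longrightarrow> b \<in> P \<Longrightarrow> c \<in> P \<Longrightarrow> d a c \<le> d a b + d b c"
  using assms unfolding compact_pseudometric_def by meson+

lemma compact_pseudometric_seq:
  assumes "compact_pseudometric P d" "\<And>k::nat. \<sigma> k \<in> P"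
  obtains l r where "l \<in> P" "strict_mono (r :: nat \<Rightarrow> nat)" "(\<lambda>k. d (\<sigma> (r k)) l) \<longlonglongrightarrow> 0"
  using assms unfolding compact_pseudometric_def by blast

lemma compact_metric_imp_pseudometric:
  assumes "compact_metric X"
  shows "compact_pseudometric (mspace X) (mdist X)"
  unfolding compact_pseudometric_def
proof (intro conjI allI impI)
  show "mspace X \<noteq> {}" using assms by (simp add: compact_metric_def)
  show "0 \<le> mdist X a b" "mdist X a b = mdist X b a" for a b
    by (simp_all add: mdist_commute)
  show "\<forall>a\<in>mspace X. mdist X a a = 0"
    by simp
  show "\<forall>a\<in>mspace X. \<forall>b\<in>mspace X. \<forall>c\<in>mspace X. mdist X a c \<le> mdist X a b + mdist X b c"
    by (simp add: mdist_triangle)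
  fix \<sigma> :: "nat \<Rightarrow> 'a" assume "\<forall>k. \<sigma> k \<in> mspace X"
  then show "\<exists>l\<in>mspace X. \<exists>r. strict_mono r \<and> (\<lambda>k. mdist X (\<sigma> (r k)) l) \<longlonglongrightarrow> 0"
    using compact_metric_seq[OF assms] by metis
qed

lemma compact_metric_image:
  assumes P: "compact_pseudometric P d" and \<pi>: "\<pi> ` P = mspace M"
    and d: "\<And>a b. a \<in> P \<Longrightarrow> b \<in> P \<Longrightarrow> mdist M (\<pi> a) (\<pi> b) = d a b"
  shows "compact_metric M"
proof (rule compact_metric_seqI)
  show "mspace M \<noteq> {}" using compact_pseudometricD(1)[OF P] \<pi> by blast
  fix \<sigma> :: "nat \<Rightarrow> 'b" assume "\<And>k. \<sigma> k \<in> mspace M"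
  then have "\<forall>k. \<exists>a\<in>P. \<sigma> k = \<pi> a" using \<pi> by blast
  then obtain \<tau> where t: "\<And>k. \<tau> k \<in> P" "\<And>k. \<sigma> k = \<pi> (\<tau> k)" by metis
  obtain l r where "l \<in> P" "strict_mono (r :: nat \<Rightarrow> nat)" "(\<lambda>k. d (\<tau> (r k)) l) \<longlonglongrightarrow> 0"
    using compact_pseudometric_seq[OF P t(1)] .
  then have "\<pi> l \<in> mspace M \<and> strict_mono r \<and> (\<lambda>k. mdist M (\<sigma> (r k)) (\<pi> l)) \<longlonglongrightarrow> 0"
    using t \<pi> d by auto
  then show "\<exists>l r. l \<in> mspace M \<and> strict_mono r \<and> (\<lambda>k. mdist M (\<sigma> (r k)) l) \<longlonglongrightarrow> 0"
    by blast
qed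

text \<open>The quotient by distance 0 is realised on representatives inside \<open>P\<close>:
  equivalent points satisfy the same choice predicate, hence receive the same representative.
  Compactness then allows transport to real points, as \<open>gh_class\<close> requires.\<close>

lemma metric_identification:
  assumes P: "compact_pseudometric P (d :: 'p \<Rightarrow> 'p \<Rightarrow> real)"
  obtains M :: "real metric" and \<pi> where "compact_metric M" "\<pi> ` P = mspace M"
    "\<And>a b. a \<in> P \<Longrightarrow> b \<in> P \<Longrightarrow> mdist M (\<pi> a) (\<pi> b) = d a b"
proof -
  note D = compact_pseudometricD[OF P]
  define rep where "rep a = (SOME b. b \<in> P \<and> d a b = 0)" for a
  have rep: "rep a \<in> P" "d a (rep a) = 0" if "a \<in> P" for a
    using someI[of "\<lambda>b. b \<in> P \<and> d a b = 0" a] D(3) that unfolding rep_def by auto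
  have eq: "d a c = d b c" if "d a b = 0" "a \<in> P" "b \<in> P" "c \<in> P" for a b c
    using D(5)[of a b c] D(5)[of b a c] D(4)[of a b] that by simp
  have rep_eq: "rep a = rep b" if "a \<in> P" "b \<in> P" "d a b = 0" for a b
  proof -
    have "(c \<in> P \<and> d a c = 0) = (c \<in> P \<and> d b c = 0)" for c
      using eq[OF that(3,1,2)] by auto
    then show ?thesis unfolding rep_def by presburger
  qed
  have d_rep: "d (rep a) (rep b) = d a b" if "a \<in> P" "b \<in> P" for a b
    using eq[of a "rep a" "rep b"] eq[of b "rep b" a] rep[OF that(1)] rep[OF that(2)] that D(4)
    by metis
  interpret Metric_space "rep ` P" d
  proof
    fix x y assume "x \<in> rep ` P" "y \<in> rep ` P"
    then obtain a b where "a \<in> P" "b \<in> P" "x = rep a" "y = rep b" by blast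
    then show "(d x y = 0) = (x = y)"
      using d_rep rep_eq D(3) by metis
  next
    fix x y z assume "x \<in> rep ` P" "y \<in> rep ` P" "z \<in> rep ` P"
    then show "d x z \<le> d x y + d y z" using rep(1) D(5) by auto
  qed (use D(2,4) in auto)
  let ?N = "metric (rep ` P, d)"
  have "compact_metric ?N"
    using d_rep by (intro compact_metric_image[OF P, of rep]) auto
  then obtain M :: "real metric" where "isometric ?N M"
    using compact_metric_isometric_real unfolding compact_metric_def by blast
  then obtain f where f: "isometric_embedding ?N M f" "f ` (rep ` P) = mspace M"
    unfolding isometric_def by auto
  have d: "mdist M ((f \<circ> rep) a) ((f \<circ> rep) b) = d a b" if "a \<in> P" "b \<in> P" for a b
    using f(1) that d_rep unfolding isometric_embedding_def by auto
  have img: "(f \<circ> rep) ` P = mspace M" using f(2) by (simp add: image_comp)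
  show ?thesis
    using that[OF compact_metric_image[OF P img d] img d] .
qed

text \<open>Between two spaces at distance \<open>r\<close> related by \<open>R\<close>, the \<open>R\<close>-component carries the usual linear
  interpolation.  The third factor \<open>W\<close> with its truncated metric does not increase the distortion,
  but near every interior point it looks like \<open>W\<close> itself.\<close>

definition bridge_dist ::
    "real \<Rightarrow> 'a metric \<Rightarrow> 'b metric \<Rightarrow> 'w metric \<Rightarrow> real \<Rightarrow> ('a \<times> 'b) \<times> 'w \<Rightarrow> ('a \<times> 'b) \<times> 'w \<Rightarrow> real" where
  "bridge_dist r X Y W t p q =
     max ((1 - t) * mdist X (fst (fst p)) (fst (fst q)) + t * mdist Y (snd (fst p)) (snd (fst q)))
         (min (mdist W (snd p) (snd q)) (2 * r * min t (1 - t)))"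

lemma bridge_dist_endpoints:
  "bridge_dist r X Y W 0 p q = mdist X (fst (fst p)) (fst (fst q))"
  "bridge_dist r X Y W 1 p q = mdist Y (snd (fst p)) (snd (fst q))"
  by (simp_all add: bridge_dist_def min_absorb2)

lemma truncated_triangle:
  fixes a b c k :: real
  shows "a \<le> b + c \<Longrightarrow> 0 \<le> b \<Longrightarrow> 0 \<le> c \<Longrightarrow> 0 \<le> k \<Longrightarrow> min a k \<le> min b k + min c k"
  by (auto simp: min_def)

lemma max_triangle:
  fixes a b c :: real
  shows "a \<le> b + c \<Longrightarrow> a' \<le> b' + c' \<Longrightarrow> max a a' \<le> max b b' + max c c'"
  by (auto simp: max_def)

text \<open>Three successive subsequences make the coordinates converge, closedness of
  \<open>R\<close> keeps the limit in the carrier, and the distance is a continuous function of the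
  three coordinate distances.\<close>

lemma compact_pseudometric_bridge:
  assumes X: "compact_metric X" and Y: "compact_metric Y" and W: "compact_metric W"
    and R: "R \<subseteq> mspace X \<times> mspace Y" "R \<noteq> {}" "closed_relation X Y R"
    and r: "0 \<le> r" and t: "t \<in> {0..1}"
  shows "compact_pseudometric (R \<times> mspace W) (bridge_dist r X Y W t)"
  unfolding compact_pseudometric_def
proof (intro conjI allI ballI impI)
  show "R \<times> mspace W \<noteq> {}" using R(2) W by (auto simp: compact_metric_def)
  have k: "0 \<le> 2 * r * min t (1 - t)" using r t by simp
  show "0 \<le> bridge_dist r X Y W t p q" for p q
    using k unfolding bridge_dist_def by (simp add: le_max_iff_disj)
  show "bridge_dist r X Y W t p q = bridge_dist r X Y W t q p" for p q
    unfolding bridge_dist_def by (simp add: mdist_commute)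
  show "bridge_dist r X Y W t p p = 0" if "p \<in> R \<times> mspace W" for p
  proof -
    have "mdist X (fst (fst p)) (fst (fst p)) = 0" "mdist Y (snd (fst p)) (snd (fst p)) = 0"
      "mdist W (snd p) (snd p) = 0"
      using that R(1) by auto
    then show ?thesis unfolding bridge_dist_def using k by simp
  qed
  show "bridge_dist r X Y W t a c \<le> bridge_dist r X Y W t a b + bridge_dist r X Y W t b c"
    if "a \<in> R \<times> mspace W" "b \<in> R \<times> mspace W" "c \<in> R \<times> mspace W" for a b c
    unfolding bridge_dist_def
  proof (intro max_triangle truncated_triangle k mdist_nonneg)
    have 1: "mdist X (fst (fst a)) (fst (fst c)) \<le> mdist X (fst (fst a)) (fst (fst b)) + mdist X (fst (fst b)) (fst (fst c))"
      "mdist Y (snd (fst a)) (snd (fst c)) \<le> mdist Y (snd (fst a)) (snd (fst b)) + mdist Y (snd (fst b)) (snd (fst c))"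
      using that R(1) by (auto intro!: mdist_triangle)
    show "(1 - t) * mdist X (fst (fst a)) (fst (fst c)) + t * mdist Y (snd (fst a)) (snd (fst c))
      \<le> ((1 - t) * mdist X (fst (fst a)) (fst (fst b)) + t * mdist Y (snd (fst a)) (snd (fst b)))
        + ((1 - t) * mdist X (fst (fst b)) (fst (fst c)) + t * mdist Y (snd (fst b)) (snd (fst c)))"
      using mult_left_mono[OF 1(1), of "1 - t"] mult_left_mono[OF 1(2), of t] t
      by (simp add: distrib_left)
    show "mdist W (snd a) (snd c) \<le> mdist W (snd a) (snd b) + mdist W (snd b) (snd c)"
      using that by (auto intro!: mdist_triangle)
  qed
  fix \<sigma> :: "nat \<Rightarrow> ('a \<times> 'b) \<times> 'c"
  assume s: "\<forall>k. \<sigma> k \<in> R \<times> mspace W"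
  have m: "fst (fst (\<sigma> k)) \<in> mspace X" "snd (fst (\<sigma> k)) \<in> mspace Y" "snd (\<sigma> k) \<in> mspace W"
    "fst (\<sigma> k) \<in> R" for k
    using s R(1) by (auto simp: mem_Times_iff dest!: spec[of _ k])
  obtain x f where x: "x \<in> mspace X" and f: "strict_mono (f :: nat \<Rightarrow> nat)"
    and lx: "(\<lambda>k. mdist X (fst (fst (\<sigma> (f k)))) x) \<longlonglongrightarrow> 0"
    using compact_metric_seq[OF X m(1)] .
  obtain y g where y: "y \<in> mspace Y" and g: "strict_mono (g :: nat \<Rightarrow> nat)"
    and ly: "(\<lambda>k. mdist Y (snd (fst (\<sigma> (f (g k))))) y) \<longlonglongrightarrow> 0"
    using compact_metric_seq[OF Y, of "\<lambda>k. snd (fst (\<sigma> (f k)))"] m(2) by metis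
  obtain w h where w: "w \<in> mspace W" and h: "strict_mono (h :: nat \<Rightarrow> nat)"
    and lw: "(\<lambda>k. mdist W (snd (\<sigma> (f (g (h k))))) w) \<longlonglongrightarrow> 0"
    using compact_metric_seq[OF W, of "\<lambda>k. snd (\<sigma> (f (g k)))"] m(3) by metis
  have lx': "(\<lambda>k. mdist X (fst (fst (\<sigma> (f (g (h k)))))) x) \<longlonglongrightarrow> 0"
    using LIMSEQ_subseq_LIMSEQ[OF lx strict_mono_o[OF g h]] by (simp add: comp_def)
  have ly': "(\<lambda>k. mdist Y (snd (fst (\<sigma> (f (g (h k)))))) y) \<longlonglongrightarrow> 0"
    using LIMSEQ_subseq_LIMSEQ[OF ly h] by (simp add: comp_def)
  have "(x, y) \<in> R"
    using R(3) m(4) x y lx' ly' unfolding closed_relation_def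
    by (elim allE[of _ "\<lambda>k. fst (\<sigma> (f (g (h k))))"]) auto
  moreover have "(\<lambda>k. bridge_dist r X Y W t (\<sigma> (f (g (h k)))) ((x, y), w)) \<longlonglongrightarrow> 0"
  proof -
    have "(\<lambda>k. bridge_dist r X Y W t (\<sigma> (f (g (h k)))) ((x, y), w)) \<longlonglongrightarrow>
        max ((1 - t) * 0 + t * 0) (min 0 (2 * r * min t (1 - t)))"
      unfolding bridge_dist_def fst_conv snd_conv
      by (intro tendsto_max tendsto_min tendsto_add tendsto_mult tendsto_const lx' ly' lw)
    then show ?thesis using k by simp
  qed
  moreover have "strict_mono (\<lambda>k. f (g (h k)))"
    using strict_mono_o[OF f strict_mono_o[OF g h]] by (simp add: comp_def)
  ultimately show "\<exists>l\<in>R \<times> mspace W. \<exists>r'. strict_mono r' \<and> (\<lambda>k. bridge_dist r X Y W t (\<sigma> (r' k)) l) \<longlonglongrightarrow> 0"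
    using w by (intro bexI[of _ "((x, y), w)"] exI[of _ "\<lambda>k. f (g (h k))"]) auto
qed

text \<open>The interpolation has slope at most \<open>2 * r\<close> by the distortion bound, and
  the truncation level because \<open>min t (1 - t)\<close> is 1-Lipschitz. A maximum changes by no
  more than the larger change of its two arguments, so the two slopes do not add up.\<close>

lemma bridge_dist_Lipschitz:
  assumes dis: "\<bar>mdist X (fst (fst p)) (fst (fst q)) - mdist Y (snd (fst p)) (snd (fst q))\<bar> \<le> 2 * r"
    and r: "0 \<le> r"
  shows "\<bar>bridge_dist r X Y W s p q - bridge_dist r X Y W t p q\<bar> \<le> 2 * (r * \<bar>s - t\<bar>)"
proof -
  let ?x = "mdist X (fst (fst p)) (fst (fst q))" and ?y = "mdist Y (snd (fst p)) (snd (fst q))"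
  have mx: "\<bar>max a b - max a' b'\<bar> \<le> c" if "\<bar>a - a'\<bar> \<le> c" "\<bar>b - b'\<bar> \<le> c" for a b a' b' c :: real
    using that by (auto simp: max_def abs_le_iff)
  have mn: "\<bar>min a b - min a b'\<bar> \<le> \<bar>b - b'\<bar>" for a b b' :: real
    by (auto simp: min_def abs_le_iff)
  have "((1 - s) * ?x + s * ?y) - ((1 - t) * ?x + t * ?y) = (s - t) * (?y - ?x)"
    by (simp add: algebra_simps)
  then have "\<bar>((1 - s) * ?x + s * ?y) - ((1 - t) * ?x + t * ?y)\<bar> = \<bar>s - t\<bar> * \<bar>?x - ?y\<bar>"
    by (simp add: abs_mult abs_minus_commute)
  also have "\<dots> \<le> \<bar>s - t\<bar> * (2 * r)"
    using dis by (intro mult_left_mono) auto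
  finally have 1: "\<bar>((1 - s) * ?x + s * ?y) - ((1 - t) * ?x + t * ?y)\<bar> \<le> 2 * (r * \<bar>s - t\<bar>)"
    by (simp add: mult_ac)
  have "\<bar>2 * r * min s (1 - s) - 2 * r * min t (1 - t)\<bar> = 2 * r * \<bar>min s (1 - s) - min t (1 - t)\<bar>"
    using r by (simp add: abs_mult flip: right_diff_distrib)
  also have "\<dots> \<le> 2 * r * \<bar>s - t\<bar>"
    using r by (intro mult_left_mono) (auto simp: min_def abs_le_iff)
  finally have 2: "\<bar>2 * r * min s (1 - s) - 2 * r * min t (1 - t)\<bar> \<le> 2 * (r * \<bar>s - t\<bar>)"
    by simp
  show ?thesis
    unfolding bridge_dist_def using 1 order_trans[OF mn 2] by (intro mx)
qed

text \<open>Fits spaces that are images of one parameter set: points with the same parameter are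
  paired.\<close>

lemma correspondence_image:
  assumes "p ` P = mspace X" "q ` P = mspace Y"
    and "\<And>a b. a \<in> P \<Longrightarrow> b \<in> P \<Longrightarrow> \<bar>mdist X (p a) (p b) - mdist Y (q a) (q b)\<bar> \<le> c"
  shows "correspondence X Y c ((\<lambda>a. (p a, q a)) ` P)"
proof -
  have "fst ` (\<lambda>a. (p a, q a)) ` P = mspace X" "snd ` (\<lambda>a. (p a, q a)) ` P = mspace Y"
    using assms(1,2) by (simp_all add: image_image)
  then show ?thesis
    unfolding correspondence_def using assms by auto
qed

text \<open>The parametrisations \<open>\<pi>\<close> and the explicit distance stay visible in the
  conclusion because each application has to inspect the interior spaces itself. At the ends the
  distance is pulled back from \<open>X\<close> or \<open>Y\<close> along a surjective coordinate
  map, so pairing a point with its coordinate has distortion 0.\<close>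

lemma bridge_path:
  fixes X Y :: "real metric" and W :: "'w metric"
  assumes X: "compact_metric X" and Y: "compact_metric Y" and W: "compact_metric W"
  obtains R and M :: "real \<Rightarrow> real metric" and \<pi> where
    "R \<subseteq> mspace X \<times> mspace Y" "R \<noteq> {}"
    "\<forall>t\<in>{0..1}. compact_metric (M t)"
    "\<forall>t\<in>{0..1}. \<pi> t ` (R \<times> mspace W) = mspace (M t)"
    "\<forall>t\<in>{0..1}. \<forall>p\<in>R \<times> mspace W. \<forall>q\<in>R \<times> mspace W.
       mdist (M t) (\<pi> t p) (\<pi> t q) = bridge_dist (gh_distance X Y) X Y W t p q"
    "isometric (M 0) X" "isometric (M 1) Y"
    "\<forall>s\<in>{0..1}. \<forall>t\<in>{0..1}. gh_distance (M s) (M t) \<le> gh_distance X Y * \<bar>s - t\<bar>"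
proof -
  let ?r = "gh_distance X Y"
  have r: "0 \<le> ?r" using gh_distance_nonneg[OF X Y] .
  obtain R where R: "correspondence X Y (2 * ?r) R" "closed_relation X Y R"
    using optimal_correspondence[OF X Y] .
  have RXY: "R \<subseteq> mspace X \<times> mspace Y" and R1: "fst ` R = mspace X" and R2: "snd ` R = mspace Y"
    using R(1) unfolding correspondence_def by blast+
  have Rne: "R \<noteq> {}" using correspondence_nonempty[OF R(1) X] .
  let ?P = "R \<times> mspace W"
  have "\<exists>(M :: real metric) \<pi>. compact_metric M \<and> \<pi> ` ?P = mspace M \<and>
      (\<forall>p\<in>?P. \<forall>q\<in>?P. mdist M (\<pi> p) (\<pi> q) = bridge_dist ?r X Y W t p q)" if t: "t \<in> {0..1}" for t
  proof -
    obtain M :: "real metric" and \<pi> where "compact_metric M" "\<pi> ` ?P = mspace M"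
      "\<And>p q. p \<in> ?P \<Longrightarrow> q \<in> ?P \<Longrightarrow> mdist M (\<pi> p) (\<pi> q) = bridge_dist ?r X Y W t p q"
      using metric_identification[OF compact_pseudometric_bridge[OF X Y W RXY Rne R(2) r t]] by metis
    then show ?thesis by blast
  qed
  then obtain M :: "real \<Rightarrow> real metric" and \<pi> where
    M: "\<And>t. t \<in> {0..1} \<Longrightarrow> compact_metric (M t)"
    and \<pi>: "\<And>t. t \<in> {0..1} \<Longrightarrow> \<pi> t ` ?P = mspace (M t)"
    and d: "\<And>t p q. t \<in> {0..1} \<Longrightarrow> p \<in> ?P \<Longrightarrow> q \<in> ?P \<Longrightarrow>
      mdist (M t) (\<pi> t p) (\<pi> t q) = bridge_dist ?r X Y W t p q"
    by metis
  have ne: "mspace W \<noteq> {}" using W by (simp add: compact_metric_def)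
  show ?thesis
  proof (rule that[OF RXY Rne])
    show "\<forall>t\<in>{0..1}. compact_metric (M t)" using M by blast
    show "\<forall>t\<in>{0..1}. \<pi> t ` ?P = mspace (M t)" using \<pi> by blast
    show "\<forall>t\<in>{0..1}. \<forall>p\<in>?P. \<forall>q\<in>?P.
       mdist (M t) (\<pi> t p) (\<pi> t q) = bridge_dist ?r X Y W t p q" using d by blast
    have "(\<lambda>p. fst (fst p)) ` ?P = fst ` (fst ` ?P)" by (simp only: image_image)
    also have "\<dots> = mspace X" using R1 ne by simp
    finally have "(\<lambda>p. fst (fst p)) ` ?P = mspace X" .
    with \<pi>[of 0] d[of 0] have "correspondence (M 0) X 0 ((\<lambda>p. (\<pi> 0 p, fst (fst p))) ` ?P)"
      by (intro correspondence_image) (auto simp: bridge_dist_endpoints)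
    then show "isometric (M 0) X" by (rule correspondence_zero_imp_isometric)
    have "(\<lambda>p. snd (fst p)) ` ?P = snd ` (fst ` ?P)" by (simp only: image_image)
    also have "\<dots> = mspace Y" using R2 ne by simp
    finally have "(\<lambda>p. snd (fst p)) ` ?P = mspace Y" .
    with \<pi>[of 1] d[of 1] have "correspondence (M 1) Y 0 ((\<lambda>p. (\<pi> 1 p, snd (fst p))) ` ?P)"
      by (intro correspondence_image) (auto simp: bridge_dist_endpoints)
    then show "isometric (M 1) Y" by (rule correspondence_zero_imp_isometric)
    show "\<forall>s\<in>{0..1}. \<forall>t\<in>{0..1}. gh_distance (M s) (M t) \<le> ?r * \<bar>s - t\<bar>"
    proof (intro ballI)
      fix s t :: real assume st: "s \<in> {0..1}" "t \<in> {0..1}"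
      have "\<bar>mdist (M s) (\<pi> s p) (\<pi> s q) - mdist (M t) (\<pi> t p) (\<pi> t q)\<bar> \<le> 2 * (?r * \<bar>s - t\<bar>)"
        if pq: "p \<in> ?P" "q \<in> ?P" for p q
      proof -
        have "\<bar>mdist X (fst (fst p)) (fst (fst q)) - mdist Y (snd (fst p)) (snd (fst q))\<bar> \<le> 2 * ?r"
          using pq by (intro correspondence_distortion[OF R(1)]) auto
        then show ?thesis
          using bridge_dist_Lipschitz[OF _ r] d st pq by simp
      qed
      then show "gh_distance (M s) (M t) \<le> ?r * \<bar>s - t\<bar>"
        by (rule gh_distance_le_correspondence[OF M[OF st(1)] M[OF st(2)]
              correspondence_image[OF \<pi>[OF st(1)] \<pi>[OF st(2)]]])
    qed
  qed
qed

text \<open>Equal end points are joined by a constant path, so a path is demanded only for positive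
  distance, which is what makes the truncation level positive at interior times.\<close>

lemma geodesic_spaceI:
  assumes path: "\<And>X Y. compact_metric X \<Longrightarrow> compact_metric Y \<Longrightarrow> gh_class X \<in> S \<Longrightarrow> gh_class Y \<in> S \<Longrightarrow>
      0 < gh_distance X Y \<Longrightarrow>
      \<exists>M. (\<forall>t\<in>{0..1}. compact_metric (M t)) \<and> isometric (M 0) X \<and> isometric (M 1) Y \<and>
        (\<forall>s\<in>{0..1}. \<forall>t\<in>{0..1}. gh_distance (M s) (M t) \<le> gh_distance X Y * \<bar>s - t\<bar>) \<and>
        (\<forall>t. 0 < t \<longrightarrow> t < 1 \<longrightarrow> gh_class (M t) \<in> S)"
  shows "geodesic_space S d_GH"
  unfolding geodesic_space_def
proof (intro conjI ballI)
  interpret G: Metric_space UNIV d_GH by (rule Metric_space_gh)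
  show MS: "Metric_space S d_GH" by (rule G.subspace) simp
  interpret S: Metric_space S d_GH by (rule MS)
  fix P Q assume P: "P \<in> S" and Q: "Q \<in> S"
  show "\<exists>\<gamma>. continuous_map (top_of_set {0..1}) S.mtopology \<gamma> \<and> \<gamma> 0 = P \<and> \<gamma> 1 = Q \<and>
      (\<forall>s\<in>{0..1}. \<forall>t\<in>{0..1}. d_GH (\<gamma> s) (\<gamma> t) = \<bar>s - t\<bar> * d_GH P Q)"
  proof (cases "P = Q")
    case True
    then show ?thesis using P by (intro exI[of _ "\<lambda>_. P"]) auto
  next
    case False
    obtain X where X: "compact_metric X" "P = gh_class X" by (rule gh_class_cases)
    obtain Y where Y: "compact_metric Y" "Q = gh_class Y" by (rule gh_class_cases)
    let ?r = "gh_distance X Y"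
    have r: "?r = d_GH P Q" using X Y by (simp add: d_GH_gh_class)
    then have "0 < ?r" using False by simp
    then obtain M where M: "\<And>t. t \<in> {0..1} \<Longrightarrow> compact_metric (M t)"
      and M01: "isometric (M 0) X" "isometric (M 1) Y"
      and le: "\<And>s t. s \<in> {0..1} \<Longrightarrow> t \<in> {0..1} \<Longrightarrow> gh_distance (M s) (M t) \<le> ?r * \<bar>s - t\<bar>"
      and MS: "\<And>t. 0 < t \<Longrightarrow> t < 1 \<Longrightarrow> gh_class (M t) \<in> S"
      using path[OF X(1) Y(1)] P Q X Y by metis
    define \<gamma> where "\<gamma> t = gh_class (M t)" for t
    have \<gamma>0: "\<gamma> 0 = P" and \<gamma>1: "\<gamma> 1 = Q"
      using M[of 0] M[of 1] M01 X Y by (simp_all add: \<gamma>_def gh_class_eq_iff)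
    have \<gamma>S: "\<gamma> t \<in> S" if "t \<in> {0..1}" for t
      using that MS[of t] \<gamma>0 \<gamma>1 P Q unfolding \<gamma>_def[symmetric]
      by (cases "t = 0"; cases "t = 1") auto
    have \<gamma>le: "d_GH (\<gamma> s) (\<gamma> t) \<le> ?r * \<bar>s - t\<bar>" if "s \<in> {0..1}" "t \<in> {0..1}" for s t
      using le[OF that] M[OF that(1)] M[OF that(2)] by (simp add: \<gamma>_def d_GH_gh_class)
    \<comment> \<open>The three pieces of the path have lengths bounded by numbers with sum
      \<open>?r\<close>, while together they must reach \<open>?r\<close>; so no piece can be
      shorter than its bound.\<close>
    have ge: "?r * (t - s) \<le> d_GH (\<gamma> s) (\<gamma> t)" if "s \<in> {0..1}" "t \<in> {0..1}" "s \<le> t" for s t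
    proof -
      have "?r \<le> d_GH (\<gamma> 0) (\<gamma> s) + (d_GH (\<gamma> s) (\<gamma> t) + d_GH (\<gamma> t) (\<gamma> 1))"
        using G.triangle[of "\<gamma> 0" "\<gamma> s" "\<gamma> 1"] G.triangle[of "\<gamma> s" "\<gamma> t" "\<gamma> 1"] r \<gamma>0 \<gamma>1 by simp
      moreover have "d_GH (\<gamma> 0) (\<gamma> s) \<le> ?r * s" "d_GH (\<gamma> t) (\<gamma> 1) \<le> ?r * (1 - t)"
        using \<gamma>le[of 0 s] \<gamma>le[of t 1] that by auto
      ultimately show ?thesis by (simp add: algebra_simps)
    qed
    have eq: "d_GH (\<gamma> s) (\<gamma> t) = \<bar>s - t\<bar> * d_GH P Q" if st: "s \<in> {0..1}" "t \<in> {0..1}" for s t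
    proof (cases "s \<le> t")
      case True
      then show ?thesis using \<gamma>le[OF st] ge[OF st] r by (simp add: mult.commute)
    next
      case False
      then show ?thesis
        using \<gamma>le[OF st(2,1)] ge[OF st(2,1)] r G.commute[of "\<gamma> s" "\<gamma> t"] by (simp add: mult.commute)
    qed
    have "continuous_map (top_of_set {0..1}) S.mtopology \<gamma>"
    proof -
      have "Lipschitz_continuous_map (submetric euclidean_metric {0..1}) (metric (S, d_GH)) \<gamma>"
        unfolding Lipschitz_continuous_map_def
        using \<gamma>S eq by (auto simp: dist_real_def intro!: exI[of _ "d_GH P Q"])
      then show ?thesis
        using Lipschitz_continuous_imp_continuous_map mtopology_of_submetric
        by (metis S.mtopology_of mtopology_of_euclidean)
    qed
    then show ?thesis using \<gamma>0 \<gamma>1 eq by blast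
  qed
qed


section \<open>Metric criteria for isolated points and continuity\<close>

lemma openin_singleton_metric:
  assumes "x \<in> mspace m"
  shows "openin (mtopology_of m) {x} \<longleftrightarrow> (\<exists>\<epsilon>>0. \<forall>y\<in>mspace m. mdist m x y < \<epsilon> \<longrightarrow> y = x)"
proof -
  interpret Metric_space "mspace m" "mdist m" by simp
  show ?thesis
    unfolding mtopology_of_def openin_mtopology using assms by (auto simp: subset_iff)
qed

lemma continuous_map_mtopology_ofI:
  assumes "f ` mspace m \<subseteq> mspace m'"
    and "\<And>a \<epsilon>. a \<in> mspace m \<Longrightarrow> \<epsilon> > 0 \<Longrightarrow>
      \<exists>\<delta>>0. \<forall>x\<in>mspace m. mdist m a x < \<delta> \<longrightarrow> mdist m' (f a) (f x) < \<epsilon>"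
  shows "continuous_map (mtopology_of m) (mtopology_of m') f"
proof -
  interpret Metric_space "mspace m" "mdist m" by simp
  show ?thesis
    unfolding mtopology_of_def metric_continuous_map[OF Metric_space_mspace_mdist]
  proof (intro conjI assms(1) ballI allI impI)
    fix a and \<epsilon> :: real assume "a \<in> mspace m" "\<epsilon> > 0"
    from assms(2)[OF this] show "\<exists>\<delta>>0. \<forall>x. x \<in> mspace m \<and> mdist m a x < \<delta> \<longrightarrow> mdist m' (f a) (f x) < \<epsilon>"
      by auto
  qed
qed


section \<open>Dimensional functions\<close>

text \<open>A bouquet of the \<open>Y n\<close>, which shrink to the base point, the only point of \<open>Y 0\<close>: note that
  \<open>inverse (real 0) = 0\<close>.\<close>

lemma compact_bouquet:
  fixes Y :: "nat \<Rightarrow> 'a metric"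
  assumes Y: "\<And>n. compact_metric (Y n)"
    and diam: "\<And>n x y. x \<in> mspace (Y n) \<Longrightarrow> y \<in> mspace (Y n) \<Longrightarrow> mdist (Y n) x y \<le> inverse (real n)"
  obtains W :: "(nat \<times> 'a) metric"
  where "compact_metric W" "\<And>n. isometric_embedding (Y n) W (Pair n)"
proof -
  \<comment> \<open>The petals stay disjoint, and distinct petals are separated by the larger of
    their size bounds. Petal 0 has diameter at most \<open>inverse 0 = 0\<close>, so it is one
    point, at distance \<open>inverse (real n)\<close> from every point of petal
    \<open>n\<close>.\<close>
  define e where "e p q = (if fst p = fst q then mdist (Y (fst p)) (snd p) (snd q)
      else max (inverse (real (fst p))) (inverse (real (fst q))))" for p q :: "nat \<times> 'a"
  define S where "S = Sigma UNIV (\<lambda>n. mspace (Y n))"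
  have S: "snd p \<in> mspace (Y (fst p))" if "p \<in> S" for p
    using that by (auto simp: S_def)
  interpret W: Metric_space S e
  proof
    fix p q show "0 \<le> e p q" "e p q = e q p"
      by (auto simp: e_def mdist_commute le_max_iff_disj max.commute)
  next
    fix p q assume pq: "p \<in> S" "q \<in> S"
    have "0 < max (inverse (real m)) (inverse (real n))" if "m \<noteq> n" for m n :: nat
      using that by (auto simp: less_max_iff_disj)
    then have "max (inverse (real m)) (inverse (real n)) \<noteq> 0" if "m \<noteq> n" for m n :: nat
      using that by (metis less_irrefl)
    then show "(e p q = 0) = (p = q)"
      using S[OF pq(1)] S[OF pq(2)] by (auto simp: e_def prod_eq_iff)
  next
    fix p q s assume *: "p \<in> S" "q \<in> S" "s \<in> S"
    show "e p s \<le> e p q + e q s"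
    proof (cases "fst p = fst q")
      case True
      then show ?thesis
        using S[OF *(1)] S[OF *(2)] S[OF *(3)] by (auto simp: e_def intro: mdist_triangle)
    next
      case False
      show ?thesis
      proof (cases "fst p = fst s")
        case True
        \<comment> \<open>A detour through a different petal is no shortcut, since leaving petal
          \<open>n\<close> already costs the bound on its diameter.\<close>
        have "e p s \<le> inverse (real (fst p))"
          using True diam S[OF *(1)] S[OF *(3)] by (simp add: e_def)
        also have "\<dots> \<le> e p q" using False by (simp add: e_def)
        also have "\<dots> \<le> e p q + e q s" using True False by (simp add: e_def le_max_iff_disj)
        finally show ?thesis .
      next
        case F2: False
        show ?thesis
        proof (cases "fst q = fst s")
          case True
          then show ?thesis using False F2 by (simp add: e_def)
        next
          case F3: False
          have "max a c \<le> max a b + max b c" if "0 \<le> a" "0 \<le> b" "0 \<le> c" for a b c :: real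
            using that by (auto simp: max_def)
          then show ?thesis using False F2 F3 by (simp add: e_def)
        qed
      qed
    qed
  qed
  let ?W = "metric (S, e)"
  have W: "mspace ?W = S" "mdist ?W = e" by simp_all
  have pairS: "(n, y) \<in> S \<longleftrightarrow> y \<in> mspace (Y n)" for n y by (simp add: S_def)
  obtain y0 where y0: "y0 \<in> mspace (Y 0)" using Y[of 0] unfolding compact_metric_def by blast
  have "compact_metric ?W"
  proof (rule compact_metric_seqI)
    show "mspace ?W \<noteq> {}" using y0 W pairS by blast
    fix \<sigma> :: "nat \<Rightarrow> nat \<times> 'a" assume "\<And>k. \<sigma> k \<in> mspace ?W"
    then have s: "\<And>k. \<sigma> k \<in> S" by simp
    show "\<exists>l r. l \<in> mspace ?W \<and> strict_mono (r :: nat \<Rightarrow> nat) \<and> (\<lambda>k. mdist ?W (\<sigma> (r k)) l) \<longlonglongrightarrow> 0"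
    \<comment> \<open>Either some petal is visited infinitely often and its compactness applies, or
      the indices tend to infinity and the whole sequence converges to the base point.\<close>
    proof (cases "\<exists>n. infinite {k. fst (\<sigma> k) = n}")
      case True
      then obtain n where n: "infinite {k. fst (\<sigma> k) = n}" by blast
      obtain f where f: "strict_mono (f :: nat \<Rightarrow> nat)" "\<And>k. fst (\<sigma> (f k)) = n"
        using infinite_enumerate[OF n] by auto
      have "snd (\<sigma> (f k)) \<in> mspace (Y n)" for k using S[OF s, of "f k"] f(2) by simp
      then obtain l g where l: "l \<in> mspace (Y n)" and g: "strict_mono (g :: nat \<Rightarrow> nat)"
        and lim: "(\<lambda>k. mdist (Y n) (snd (\<sigma> (f (g k)))) l) \<longlonglongrightarrow> 0"
        using compact_metric_seq[OF Y[of n], of "\<lambda>k. snd (\<sigma> (f k))"] by metis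
      have "(\<lambda>k. e (\<sigma> (f (g k))) (n, l)) \<longlonglongrightarrow> 0"
        using lim by (simp add: e_def f(2))
      then show ?thesis
        using l strict_mono_o[OF f(1) g]
        by (intro exI[of _ "(n, l)"] exI[of _ "f \<circ> g"]) (simp add: pairS)
    next
      case False
      have "filterlim (\<lambda>k. fst (\<sigma> k)) at_top sequentially"
        unfolding filterlim_at_top
      proof
        fix N
        have "{k. fst (\<sigma> k) < N} = (\<Union>n<N. {k. fst (\<sigma> k) = n})" by auto
        then have "finite {k. fst (\<sigma> k) < N}" using False by simp
        then show "\<forall>\<^sub>F k in sequentially. N \<le> fst (\<sigma> k)"
          by (simp add: eventually_cofinite not_le flip: cofinite_eq_sequentially)
      qed
      then have lim: "(\<lambda>k. inverse (real (fst (\<sigma> k)))) \<longlonglongrightarrow> 0"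
        by (intro tendsto_inverse_0_at_top filterlim_compose[OF filterlim_real_sequentially])
      have "e (\<sigma> k) (0, y0) \<le> inverse (real (fst (\<sigma> k)))" for k
        using diam[of "snd (\<sigma> k)" 0 y0] y0 S[OF s, of k] by (auto simp: e_def)
      then have "(\<lambda>k. e (\<sigma> k) (0, y0)) \<longlonglongrightarrow> 0"
        by (intro tendsto_sandwich[OF _ _ tendsto_const lim]) auto
      then show ?thesis
        using y0 by (intro exI[of _ "(0, y0)"] exI[of _ id]) (simp add: pairS strict_mono_def)
    qed
  qed
  moreover have "isometric_embedding (Y n) ?W (Pair n)" for n
    unfolding isometric_embedding_def W by (auto simp: pairS e_def)
  ultimately show ?thesis using that by blast
qed

lemma mdist_le_mdiameter:
  assumes "compact_metric m" "x \<in> mspace m" "y \<in> mspace m"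
  shows "mdist m x y \<le> mdiameter m"
proof -
  obtain C where C: "\<And>x y. x \<in> mspace m \<Longrightarrow> y \<in> mspace m \<Longrightarrow> mdist m x y \<le> C"
    using compact_metric_bounded[OF assms(1)] by metis
  have bdd: "bdd_above ((\<lambda>(x, y). mdist m x y) ` (mspace m \<times> mspace m))"
    by (rule bdd_aboveI[of _ C]) (auto intro: C)
  show ?thesis
    unfolding mdiameter_def using cSUP_upper[OF _ bdd, of "(x, y)"] assms(2,3) by simp
qed

text \<open>The image of \<open>Y\<close> is compact, hence closed in the Hausdorff space
  \<open>M\<close>, and as an isometric copy it has the same class as \<open>Y\<close>; monotonicity
  of \<open>D\<close> on closed subsets then applies.\<close>

lemma infinite_dimensional_mono:
  assumes D: "dimensional_function D" and M: "compact_metric M" and Y: "compact_metric Y"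
    and emb: "isometric_embedding Y M f" and "gh_class Y \<in> infinite_dimensional D"
  shows "gh_class M \<in> infinite_dimensional D"
proof -
  let ?A = "submetric M (f ` mspace Y)"
  have sub: "f ` mspace Y \<subseteq> mspace M" using emb unfolding isometric_embedding_def by blast
  have A: "mspace ?A = f ` mspace Y" using sub by auto
  have d: "mdist ?A (f a) (f b) = mdist Y a b" if "a \<in> mspace Y" "b \<in> mspace Y" for a b
    using emb that unfolding isometric_embedding_def by simp
  have cA: "compact_metric ?A"
    by (rule compact_metric_image[OF compact_metric_imp_pseudometric[OF Y] A[symmetric] d])
  have "isometric Y ?A"
    unfolding isometric_def isometric_embedding_def using A d by blast
  then have eq: "gh_class ?A = gh_class Y"
    using gh_class_eq_iff[OF Y cA] by simp
  have "compactin (mtopology_of M) (f ` mspace Y)"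
    using cA sub unfolding compact_metric_def mtopology_of_submetric
    by (simp add: compactin_subspace)
  moreover have "Hausdorff_space (mtopology_of M)"
    unfolding mtopology_of_def by (simp add: Metric_space.Hausdorff_space_mtopology)
  ultimately have "closedin (mtopology_of M) (f ` mspace Y)"
    by (rule compactin_imp_closedin[rotated])
  moreover have "f ` mspace Y \<noteq> {}" using Y by (simp add: compact_metric_def)
  ultimately have "D (gh_class ?A) \<le> D (gh_class M)"
    using D M unfolding dimensional_function_def by blast
  then show ?thesis
    using assms(5) eq by (simp add: infinite_dimensional_def top_unique)
qed

theorem geodesic_space_infinite_dimensional:
  assumes D: "dimensional_function D"
  shows "geodesic_space (infinite_dimensional D) d_GH"
proof (rule geodesic_spaceI)
  fix X Y :: "real metric"
  assume X: "compact_metric X" and Y: "compact_metric Y" and r: "0 < gh_distance X Y"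
  \<comment> \<open>Index 0 is reserved for the one-point base of the bouquet, so infinite dimension
    is asked only of positive indices.\<close>
  have "\<exists>V :: real metric. compact_metric V \<and> (n > 0 \<longrightarrow> D (gh_class V) = \<infinity>) \<and>
      (\<forall>x\<in>mspace V. \<forall>y\<in>mspace V. mdist V x y \<le> inverse (real n))" for n
  proof (cases "n = 0")
    case True
    let ?V = "submetric euclidean_metric {0 :: real}"
    have "compact_metric ?V"
      by (rule compact_metric_seqI) (auto intro!: exI[of _ id] simp: strict_mono_def)
    then show ?thesis using True by (intro exI[of _ ?V]) auto
  next
    case False
    then have "inverse (real n) > 0" by simp
    then obtain V where "compact_metric V" "D (gh_class V) = \<infinity>" "mdiameter V \<le> inverse (real n)"
      using D unfolding dimensional_function_def by blast
    then show ?thesis using mdist_le_mdiameter[of V] by (meson order_trans)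
  qed
  then obtain V :: "nat \<Rightarrow> real metric" where V: "\<And>n. compact_metric (V n)"
    "\<And>n. n > 0 \<Longrightarrow> D (gh_class (V n)) = \<infinity>"
    "\<And>n x y. x \<in> mspace (V n) \<Longrightarrow> y \<in> mspace (V n) \<Longrightarrow> mdist (V n) x y \<le> inverse (real n)"
    by metis
  obtain W :: "(nat \<times> real) metric" where W: "compact_metric W"
    and emb: "\<And>n. isometric_embedding (V n) W (Pair n)"
    using compact_bouquet[OF V(1,3)] by metis
  obtain R and M :: "real \<Rightarrow> real metric" and \<pi> where
    R: "R \<subseteq> mspace X \<times> mspace Y" "R \<noteq> {}"
    and M: "\<forall>t\<in>{0..1}. compact_metric (M t)"
    and \<pi>: "\<forall>t\<in>{0..1}. \<pi> t ` (R \<times> mspace W) = mspace (M t)"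
    and d: "\<forall>t\<in>{0..1}. \<forall>p\<in>R \<times> mspace W. \<forall>q\<in>R \<times> mspace W.
       mdist (M t) (\<pi> t p) (\<pi> t q) = bridge_dist (gh_distance X Y) X Y W t p q"
    and ends: "isometric (M 0) X" "isometric (M 1) Y"
    and lip: "\<forall>s\<in>{0..1}. \<forall>t\<in>{0..1}. gh_distance (M s) (M t) \<le> gh_distance X Y * \<bar>s - t\<bar>"
    by (rule bridge_path[OF X Y W]) (rule that)
  have "gh_class (M t) \<in> infinite_dimensional D" if t: "0 < t" "t < 1" for t
  proof -
    let ?c = "2 * gh_distance X Y * min t (1 - t)"
    have t01: "t \<in> {0..1}" using t by simp
    note Mt = bspec[OF M t01] and \<pi>t = bspec[OF \<pi> t01] and dt = bspec[OF d t01, rule_format]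
    have "?c > 0" using r t by simp
    \<comment> \<open>\<open>V n\<close> has diameter below the truncation level, so truncation does
      not affect it. With the \<open>R\<close>-coordinate fixed at \<open>(x, y)\<close> the
      interpolation term is 0, and the copy of \<open>V n\<close> is isometric.\<close>
    then obtain n where n: "n > 0" "inverse (real n) < ?c"
      using ex_inverse_of_nat_less by blast
    obtain x y where xy: "(x, y) \<in> R" using R(2) by auto
    have m: "(n, v) \<in> mspace W" if "v \<in> mspace (V n)" for v
      using emb[of n] that unfolding isometric_embedding_def by blast
    have "isometric_embedding (V n) (M t) (\<lambda>v. \<pi> t ((x, y), (n, v)))"
      unfolding isometric_embedding_def
    proof (intro conjI ballI)
      show "(\<lambda>v. \<pi> t ((x, y), n, v)) ` mspace (V n) \<subseteq> mspace (M t)"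
        using \<pi>t m xy by force
      fix v v' assume v: "v \<in> mspace (V n)" "v' \<in> mspace (V n)"
      have "mdist W (n, v) (n, v') = mdist (V n) v v'"
        using emb[of n] v unfolding isometric_embedding_def by blast
      moreover have "mdist (V n) v v' \<le> ?c" using V(3)[OF v] n(2) by linarith
      moreover have "mdist X x x = 0" "mdist Y y y = 0" using xy R(1) by auto
      ultimately show "mdist (M t) (\<pi> t ((x, y), n, v)) (\<pi> t ((x, y), n, v')) = mdist (V n) v v'"
        using dt[of "((x, y), n, v)" "((x, y), n, v')"] m[OF v(1)] m[OF v(2)] xy
        by (simp add: bridge_dist_def min_absorb1)
    qed
    moreover have "gh_class (V n) \<in> infinite_dimensional D"
      using V(2) n(1) by (simp add: infinite_dimensional_def)
    ultimately show ?thesis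
      using infinite_dimensional_mono[OF D Mt V(1)] by blast
  qed
  then show "\<exists>M. (\<forall>t\<in>{0..1}. compact_metric (M t)) \<and> isometric (M 0) X \<and> isometric (M 1) Y \<and>
        (\<forall>s\<in>{0..1}. \<forall>t\<in>{0..1}. gh_distance (M s) (M t) \<le> gh_distance X Y * \<bar>s - t\<bar>) \<and>
        (\<forall>t. 0 < t \<longrightarrow> t < 1 \<longrightarrow> gh_class (M t) \<in> infinite_dimensional D)"
    using M ends lip by blast
qed


section \<open>Cantor metric spaces\<close>

lemma homeomorphic_cantor_setI:
  assumes M: "compact_metric M"
    and perfect: "\<And>x. x \<in> mspace M \<Longrightarrow> \<not> openin (mtopology_of M) {x}"
    and \<B>: "countable \<B>" "\<And>B. B \<in> \<B> \<Longrightarrow> clopenin (mtopology_of M) B" "separates_points (mtopology_of M) \<B>"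
  shows "mtopology_of M homeomorphic_space top_of_set cantor_set"
proof -
  have "mtopology_of M homeomorphic_space (euclidean :: (nat \<Rightarrow> bool) topology)"
    using M perfect \<B> by (intro homeomorphic_space_Cantor) (auto simp: compact_metric_def)
  then show ?thesis
    using cantor_set_homeomorphic homeomorphic_space_sym homeomorphic_space_trans by blast
qed

text \<open>Preimages are cut down to the carrier because \<open>clopenin\<close> admits only
  subsets of it.\<close>

definition pullback_family :: "'a topology \<Rightarrow> ('a \<Rightarrow> 'b) \<Rightarrow> 'b set set \<Rightarrow> 'a set set" where
  "pullback_family T f \<B> = (\<lambda>B. {x \<in> topspace T. f x \<in> B}) ` \<B>"

lemma clopenin_pullback_family:
  assumes "continuous_map T T' f" "countable \<B>" "\<And>B. B \<in> \<B> \<Longrightarrow> clopenin T' B"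
  shows "countable (pullback_family T f \<B>)"
    and "B \<in> pullback_family T f \<B> \<Longrightarrow> clopenin T B"
  using assms(2,3) clopenin_vimage[OF assms(1)] unfolding pullback_family_def by blast+

lemma pullback_family_separates:
  assumes "continuous_map T T' f" "separates_points T' \<B>" "x \<in> topspace T" "y \<in> topspace T" "f x \<noteq> f y"
  shows "\<exists>B\<in>pullback_family T f \<B>. \<not> (x \<in> B \<longleftrightarrow> y \<in> B)"
proof -
  have "f x \<in> topspace T'" "f y \<in> topspace T'"
    using assms continuous_map_image_subset_topspace by blast+
  then obtain B where "B \<in> \<B>" "\<not> (f x \<in> B \<longleftrightarrow> f y \<in> B)"
    using assms unfolding separates_points_def by blast
  then show ?thesis using assms unfolding pullback_family_def by auto
qed

theorem geodesic_space_cantor: "geodesic_space cantor_metric_spaces d_GH"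
proof (rule geodesic_spaceI)
  fix X Y :: "real metric"
  assume X: "compact_metric X" and Y: "compact_metric Y" and r: "0 < gh_distance X Y"
    and XC: "gh_class X \<in> cantor_metric_spaces" and YC: "gh_class Y \<in> cantor_metric_spaces"
  \<comment> \<open>\<open>cantor_metric_spaces\<close> is an image under \<open>gh_class\<close>,
    so membership speaks of some representative only; the homeomorphism is carried over to
    \<open>Z\<close> along an isometry.\<close>
  have hom: "mtopology_of Z homeomorphic_space top_of_set cantor_set"
    if Z: "compact_metric Z" "gh_class Z \<in> cantor_metric_spaces" for Z
  proof -
    obtain Z' where Z': "compact_metric Z'" "mtopology_of Z' homeomorphic_space top_of_set cantor_set"
      "gh_class Z = gh_class Z'"
      using Z(2) unfolding cantor_metric_spaces_def by blast
    have "isometric Z Z'" using gh_class_eq_iff[OF Z(1) Z'(1)] Z'(3) by simp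
    then obtain f where f: "isometric_embedding Z Z' f" "f ` mspace Z = mspace Z'"
      unfolding isometric_def by blast
    have "continuous_map (mtopology_of Z) (mtopology_of Z') f"
      using f by (intro continuous_map_mtopology_ofI) (auto simp: isometric_embedding_def)
    moreover have "Hausdorff_space (mtopology_of Z')"
      unfolding mtopology_of_def by (simp add: Metric_space.Hausdorff_space_mtopology)
    ultimately have "homeomorphic_map (mtopology_of Z) (mtopology_of Z') f"
      using Z(1) f isometric_embedding_inj[OF f(1)]
      by (intro continuous_imp_homeomorphic_map) (auto simp: compact_metric_def)
    then show ?thesis
      using Z'(2) homeomorphic_map_imp_homeomorphic_space homeomorphic_space_trans by blast
  qed
  obtain \<X> where \<X>: "countable \<X>" "\<And>B. B \<in> \<X> \<Longrightarrow> clopenin (mtopology_of X) B"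
    "separates_points (mtopology_of X) \<X>"
    and Xperf: "\<And>x. x \<in> topspace (mtopology_of X) \<Longrightarrow> \<not> openin (mtopology_of X) {x}"
    using homeomorphic_cantor_set_imp[OF hom[OF X XC]] by metis
  obtain \<Y> where \<Y>: "countable \<Y>" "\<And>B. B \<in> \<Y> \<Longrightarrow> clopenin (mtopology_of Y) B"
    "separates_points (mtopology_of Y) \<Y>"
    using homeomorphic_cantor_set_imp[OF hom[OF Y YC]] by metis
  obtain R and M :: "real \<Rightarrow> real metric" and \<pi> where
    R: "R \<subseteq> mspace X \<times> mspace Y" "R \<noteq> {}"
    and M: "\<forall>t\<in>{0..1}. compact_metric (M t)"
    and \<pi>: "\<forall>t\<in>{0..1}. \<pi> t ` (R \<times> mspace X) = mspace (M t)"
    and d: "\<forall>t\<in>{0..1}. \<forall>p\<in>R \<times> mspace X. \<forall>q\<in>R \<times> mspace X.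
       mdist (M t) (\<pi> t p) (\<pi> t q) = bridge_dist (gh_distance X Y) X Y X t p q"
    and ends: "isometric (M 0) X" "isometric (M 1) Y"
    and lip: "\<forall>s\<in>{0..1}. \<forall>t\<in>{0..1}. gh_distance (M s) (M t) \<le> gh_distance X Y * \<bar>s - t\<bar>"
    by (rule bridge_path[OF X Y X]) (rule that)
  have "gh_class (M t) \<in> cantor_metric_spaces" if t: "0 < t" "t < 1" for t
  proof -
    let ?P = "R \<times> mspace X" and ?T = "mtopology_of (M t)"
    let ?c = "2 * gh_distance X Y * min t (1 - t)"
    have c: "?c > 0" using r t by simp
    have t01: "t \<in> {0..1}" using t by simp
    note Mt = bspec[OF M t01] and \<pi>t = bspec[OF \<pi> t01] and dt = bspec[OF d t01, rule_format]
    \<comment> \<open>A choice of parameters for the points of \<open>M t\<close>. Its three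
      coordinates are continuous because at interior times the weights \<open>1 - t\<close> and
      \<open>t\<close> and the level \<open>?c\<close> are all positive.\<close>
    define s where "s = inv_into ?P (\<pi> t)"
    have s: "s z \<in> ?P" "\<pi> t (s z) = z" if "z \<in> mspace (M t)" for z
      using that \<pi>t unfolding s_def by (metis inv_into_into, metis f_inv_into_f)
    have dd: "mdist (M t) z z' = bridge_dist (gh_distance X Y) X Y X t (s z) (s z')"
      if "z \<in> mspace (M t)" "z' \<in> mspace (M t)" for z z'
      using dt[OF s(1)[OF that(1)] s(1)[OF that(2)]] s(2)[OF that(1)] s(2)[OF that(2)] by simp
    define f1 f2 f3 where "f1 z = fst (fst (s z))" and "f2 z = snd (fst (s z))" and "f3 z = snd (s z)" for z
    have fm: "f1 z \<in> mspace X" "f2 z \<in> mspace Y" "f3 z \<in> mspace X" if "z \<in> mspace (M t)" for z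
      using s(1)[OF that] R(1) unfolding f1_def f2_def f3_def by (auto simp: mem_Times_iff)
    have b1: "(1 - t) * mdist X (f1 z) (f1 z') \<le> mdist (M t) z z'"
      and b2: "t * mdist Y (f2 z) (f2 z') \<le> mdist (M t) z z'"
      and b3: "min (mdist X (f3 z) (f3 z')) ?c \<le> mdist (M t) z z'"
      if zz: "z \<in> mspace (M t)" "z' \<in> mspace (M t)" for z z'
    proof -
      have "0 \<le> (1 - t) * mdist X (f1 z) (f1 z')" "0 \<le> t * mdist Y (f2 z) (f2 z')" using t by simp_all
      then show "(1 - t) * mdist X (f1 z) (f1 z') \<le> mdist (M t) z z'"
        "t * mdist Y (f2 z) (f2 z') \<le> mdist (M t) z z'"
        unfolding dd[OF zz] bridge_dist_def f1_def f2_def by (simp_all add: le_max_iff_disj)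
      show "min (mdist X (f3 z) (f3 z')) ?c \<le> mdist (M t) z z'"
        unfolding dd[OF zz] bridge_dist_def f3_def by simp
    qed
    have c1: "continuous_map ?T (mtopology_of X) f1"
    proof (rule continuous_map_mtopology_ofI)
      fix z and \<epsilon> :: real assume z: "z \<in> mspace (M t)" and "\<epsilon> > 0"
      show "\<exists>\<delta>>0. \<forall>x\<in>mspace (M t). mdist (M t) z x < \<delta> \<longrightarrow> mdist X (f1 z) (f1 x) < \<epsilon>"
      proof (intro exI[of _ "(1 - t) * \<epsilon>"] conjI ballI impI)
        fix x assume x: "x \<in> mspace (M t)" "mdist (M t) z x < (1 - t) * \<epsilon>"
        then have "(1 - t) * mdist X (f1 z) (f1 x) < (1 - t) * \<epsilon>" using b1[OF z x(1)] by linarith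
        then show "mdist X (f1 z) (f1 x) < \<epsilon>" using t by simp
      qed (use t \<open>\<epsilon> > 0\<close> in simp)
    qed (use fm in auto)
    have c2: "continuous_map ?T (mtopology_of Y) f2"
    proof (rule continuous_map_mtopology_ofI)
      fix z and \<epsilon> :: real assume z: "z \<in> mspace (M t)" and "\<epsilon> > 0"
      show "\<exists>\<delta>>0. \<forall>x\<in>mspace (M t). mdist (M t) z x < \<delta> \<longrightarrow> mdist Y (f2 z) (f2 x) < \<epsilon>"
      proof (intro exI[of _ "t * \<epsilon>"] conjI ballI impI)
        fix x assume x: "x \<in> mspace (M t)" "mdist (M t) z x < t * \<epsilon>"
        then have "t * mdist Y (f2 z) (f2 x) < t * \<epsilon>" using b2[OF z x(1)] by linarith
        then show "mdist Y (f2 z) (f2 x) < \<epsilon>" using t by simp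
      qed (use t \<open>\<epsilon> > 0\<close> in simp)
    qed (use fm in auto)
    have c3: "continuous_map ?T (mtopology_of X) f3"
    proof (rule continuous_map_mtopology_ofI)
      fix z and \<epsilon> :: real assume z: "z \<in> mspace (M t)" and "\<epsilon> > 0"
      show "\<exists>\<delta>>0. \<forall>x\<in>mspace (M t). mdist (M t) z x < \<delta> \<longrightarrow> mdist X (f3 z) (f3 x) < \<epsilon>"
      proof (intro exI[of _ "min \<epsilon> ?c"] conjI ballI impI)
        fix x assume x: "x \<in> mspace (M t)" "mdist (M t) z x < min \<epsilon> ?c"
        then show "mdist X (f3 z) (f3 x) < \<epsilon>" using b3[OF z x(1)] by (auto simp: min_less_iff_disj)
      qed (use c \<open>\<epsilon> > 0\<close> in simp)
    qed (use fm in auto)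
    define \<B> where "\<B> = pullback_family ?T f1 \<X> \<union> pullback_family ?T f2 \<Y> \<union> pullback_family ?T f3 \<X>"
    have "?T homeomorphic_space top_of_set cantor_set"
    proof (rule homeomorphic_cantor_setI[OF Mt])
      show "countable \<B>"
        unfolding \<B>_def
        using clopenin_pullback_family(1)[OF c1 \<X>(1,2)] clopenin_pullback_family(1)[OF c2 \<Y>(1,2)]
          clopenin_pullback_family(1)[OF c3 \<X>(1,2)] by simp
      show "clopenin ?T B" if "B \<in> \<B>" for B
        using that clopenin_pullback_family(2)[OF c1 \<X>(1,2)] clopenin_pullback_family(2)[OF c2 \<Y>(1,2)]
          clopenin_pullback_family(2)[OF c3 \<X>(1,2)] unfolding \<B>_def by blast
      show "separates_points ?T \<B>"
        unfolding separates_points_def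
      proof (intro ballI impI)
        fix z z' assume z: "z \<in> topspace ?T" "z' \<in> topspace ?T" "z \<noteq> z'"
        \<comment> \<open>A point is recovered from its parameter by \<open>\<pi> t\<close>, so
          distinct points differ in at least one of the three coordinates.\<close>
        then have "s z \<noteq> s z'" using s(2) by (metis topspace_mtopology_of)
        then have "f1 z \<noteq> f1 z' \<or> f2 z \<noteq> f2 z' \<or> f3 z \<noteq> f3 z'"
          unfolding f1_def f2_def f3_def by (auto simp: prod_eq_iff)
        then show "\<exists>B\<in>\<B>. \<not> (z \<in> B \<longleftrightarrow> z' \<in> B)"
          using pullback_family_separates[OF c1 \<X>(3) z(1,2)] pullback_family_separates[OF c2 \<Y>(3) z(1,2)]
            pullback_family_separates[OF c3 \<X>(3) z(1,2)]
          unfolding \<B>_def by blast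
      qed
      show "\<not> openin ?T {z}" if z: "z \<in> mspace (M t)" for z
      proof
        assume "openin ?T {z}"
        then obtain \<epsilon> where e: "\<epsilon> > 0" "\<And>z'. z' \<in> mspace (M t) \<Longrightarrow> mdist (M t) z z' < \<epsilon> \<Longrightarrow> z' = z"
          using openin_singleton_metric[OF z] by blast
        obtain x y w where xyw: "s z = ((x, y), w)" by (metis prod.collapse)
        have m: "((x, y), w) \<in> ?P" using s(1)[OF z] xyw by simp
        then have w: "w \<in> mspace X" by simp
        \<comment> \<open>Only the third coordinate is moved: \<open>X\<close> has no isolated
          points, so some \<open>w'\<close> lies arbitrarily close to \<open>w\<close>, and the new
          point stays within \<open>\<epsilon>\<close> since truncation can only shorten
          distances.\<close>
        then obtain w' where w': "w' \<in> mspace X" "mdist X w w' < \<epsilon>" "w' \<noteq> w"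
          using Xperf[of w] openin_singleton_metric[OF w] e(1) by auto
        have m': "((x, y), w') \<in> ?P" using m w' by simp
        have "mdist X x x = 0" "mdist Y y y = 0" using m R(1) by auto
        then have "mdist (M t) z (\<pi> t ((x, y), w')) = max 0 (min (mdist X w w') ?c)"
          using dt[OF m m'] s(2)[OF z] xyw by (simp add: bridge_dist_def)
        moreover have "mdist X w w' > 0" using w w' by (metis mdist_nonneg mdist_zero order_le_less)
        ultimately have "0 < mdist (M t) z (\<pi> t ((x, y), w'))" "mdist (M t) z (\<pi> t ((x, y), w')) < \<epsilon>"
          using c w'(2) e(1) by (auto simp: max_def min_def)
        moreover have "\<pi> t ((x, y), w') \<in> mspace (M t)" using m' \<pi>t by blast
        ultimately have "0 < mdist (M t) z z" using e(2)[of "\<pi> t ((x, y), w')"] by simp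
        moreover have "mdist (M t) z z = 0" using z by simp
        ultimately show False by linarith
      qed
    qed
    then show ?thesis
      using Mt unfolding cantor_metric_spaces_def by blast
  qed
  then show "\<exists>M. (\<forall>t\<in>{0..1}. compact_metric (M t)) \<and> isometric (M 0) X \<and> isometric (M 1) Y \<and>
        (\<forall>s\<in>{0..1}. \<forall>t\<in>{0..1}. gh_distance (M s) (M t) \<le> gh_distance X Y * \<bar>s - t\<bar>) \<and>
        (\<forall>t. 0 < t \<longrightarrow> t < 1 \<longrightarrow> gh_class (M t) \<in> cantor_metric_spaces)"
    using M ends lip by blast
qed

theorem corollary5p7:
  shows "(\<forall>D :: gh_space \<Rightarrow> ennreal. dimensional_function D \<longrightarrow>
            geodesic_space (infinite_dimensional D) d_GH) \<and>
         geodesic_space cantor_metric_spaces d_GH"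
  by (intro conjI allI impI geodesic_space_infinite_dimensional geodesic_space_cantor)

end
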